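(* Let $V$ be a vector space of finite dimension $n$ over a field $\mathbb{F}$, endowed with a symplectic form of maximal rank. If $|\mathbb{F}|\ge 3$, then every residue of rank at least $3$ of the geometry $\Gamma=\Gamma(V)$ is simply connected.
   Context: For $U\le V$ let $U^\perp$ be its orthogonal with respect to the form and $\mathrm{Rad}(U)=U\cap U^\perp$. Maximal rank means $\dim\mathrm{Rad}(V)=0$ if $n$ is even and $1$ if $n$ is odd. $\Gamma(V)$ has type set $I=\{1,\dots,n-1\}$. Its objects of type $i$ are the $i$-dimensional subspaces $U\le V$ with $U\cap\mathrm{Rad}(V)=0$ and $\dim\mathrm{Rad}(U)\le 1$. Each object is incident with itself, and objects $X,Y$ with $\dim X<\dim Y$ are incident iff $X\subseteq Y$ and $X\cap\mathrm{Rad}(Y)=0$. Distinct objects of equal dimension are not incident. A flag is a (possibly empty) set of pairwise incident objects. The residue of a flag $F$ consists of all objects not in $F$ that are incident with every element of $F$, with the induced types and incidence; its rank is $|I|-|F|$. A path is a sequence of objects $x_0,\dots,x_k$ with consecutive objects distinct and incident; a cycle based at $x$ is a path with $x_0=x=x_k$. Two paths are homotopy equivalent if one is obtained from the other by a finite number of insertions or eliminations of cycles of length $2$ or $3$. A geometry is simply connected if its incidence graph is connected and every cycle is homotopy equivalent to a cycle of length $0$. *)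

theory Defs
  imports Complex_Main
begin

text \<open>Incidence structures are given by a set of objects and an incidence relation, of which only
  the restriction to the objects matters.\<close>

definition flag :: "'o set \<Rightarrow> ('o \<Rightarrow> 'o \<Rightarrow> bool) \<Rightarrow> 'o set \<Rightarrow> bool" where
  "flag Ob inc F \<longleftrightarrow> F \<subseteq> Ob \<and> (\<forall>X\<in>F. \<forall>Y\<in>F. inc X Y)"

definition flag_residue :: "'o set \<Rightarrow> ('o \<Rightarrow> 'o \<Rightarrow> bool) \<Rightarrow> 'o set \<Rightarrow> 'o set" where
  "flag_residue Ob inc F = {X \<in> Ob - F. \<forall>Y\<in>F. inc X Y}"

text \<open>In \<open>\<Gamma>(V)\<close> incident objects of equal dimension coincide, so flags are finite with at most one
  element of each type, and the subtraction below does not truncate.\<close>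

definition residue_rank :: "nat set \<Rightarrow> 'o set \<Rightarrow> nat" where
  "residue_rank I F = card I - card F"

text \<open>The path \<open>x\<^sub>0, \<dots>, x\<^sub>k\<close> is the list \<open>[x\<^sub>0, \<dots>, x\<^sub>k]\<close>; its length is \<open>k\<close>,
  one less than the length of the list.\<close>

definition inc_path :: "'o set \<Rightarrow> ('o \<Rightarrow> 'o \<Rightarrow> bool) \<Rightarrow> 'o list \<Rightarrow> bool" where
  "inc_path Ob inc p \<longleftrightarrow>
     p \<noteq> [] \<and> set p \<subseteq> Ob \<and> successively (\<lambda>x y. x \<noteq> y \<and> inc x y) p"

definition inc_path_length :: "'o list \<Rightarrow> nat" where
  "inc_path_length p = length p - 1"

definition inc_cycle :: "'o set \<Rightarrow> ('o \<Rightarrow> 'o \<Rightarrow> bool) \<Rightarrow> 'o \<Rightarrow> 'o list \<Rightarrow> bool" where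
  "inc_cycle Ob inc x c \<longleftrightarrow> inc_path Ob inc c \<and> hd c = x \<and> last c = x"

text \<open>Inserting a cycle \<open>c\<close> based at an entry \<open>x\<close> of a path replaces that entry by \<open>c\<close>.\<close>

definition cycle_insertion ::
  "'o set \<Rightarrow> ('o \<Rightarrow> 'o \<Rightarrow> bool) \<Rightarrow> 'o list \<Rightarrow> 'o list \<Rightarrow> bool" where
  "cycle_insertion Ob inc p q \<longleftrightarrow> inc_path Ob inc p \<and>
     (\<exists>us x vs c. inc_cycle Ob inc x c \<and> inc_path_length c \<in> {2, 3} \<and>
        p = us @ [x] @ vs \<and> q = us @ c @ vs)"

definition inc_homotopic ::
  "'o set \<Rightarrow> ('o \<Rightarrow> 'o \<Rightarrow> bool) \<Rightarrow> 'o list \<Rightarrow> 'o list \<Rightarrow> bool" where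
  "inc_homotopic Ob inc = equivclp (cycle_insertion Ob inc)"

definition inc_connected :: "'o set \<Rightarrow> ('o \<Rightarrow> 'o \<Rightarrow> bool) \<Rightarrow> bool" where
  "inc_connected Ob inc \<longleftrightarrow> Ob \<noteq> {} \<and>
     (\<forall>x\<in>Ob. \<forall>y\<in>Ob. \<exists>p. inc_path Ob inc p \<and> hd p = x \<and> last p = y)"

definition inc_simply_connected :: "'o set \<Rightarrow> ('o \<Rightarrow> 'o \<Rightarrow> bool) \<Rightarrow> bool" where
  "inc_simply_connected Ob inc \<longleftrightarrow> inc_connected Ob inc \<and>
     (\<forall>x c. inc_cycle Ob inc x c \<longrightarrow>
        (\<exists>y d. inc_cycle Ob inc y d \<and> inc_path_length d = 0 \<and> inc_homotopic Ob inc c d))"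

text \<open>\<open>V\<close> is the whole type \<open>'v\<close>, and the field acts on itself by multiplication.
  A symplectic form is an alternating bilinear form, not assumed nondegenerate.\<close>

locale symplectic_space = finite_dimensional_vector_space scale Basis
  for scale :: "'f::field \<Rightarrow> 'v::ab_group_add \<Rightarrow> 'v" and Basis :: "'v set" +
  fixes form :: "'v \<Rightarrow> 'v \<Rightarrow> 'f"
  assumes form_linear_left: "Vector_Spaces.linear scale (*) (\<lambda>x. form x y)"
    and form_linear_right: "Vector_Spaces.linear scale (*) (\<lambda>y. form x y)"
    and form_alternating: "form x x = 0"
begin

definition perp :: "'v set \<Rightarrow> 'v set" where
  "perp U = {v. \<forall>u\<in>U. form u v = 0}"

definition Rad :: "'v set \<Rightarrow> 'v set" where
  "Rad U = U \<inter> perp U"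

definition maximal_rank :: bool where
  "maximal_rank \<longleftrightarrow> dim (Rad UNIV) = (if even (dim (UNIV :: 'v set)) then 0 else 1)"

definition Gamma_types :: "nat set" where
  "Gamma_types = {1..dim (UNIV :: 'v set) - 1}"

definition Gamma_objects :: "'v set set" where
  "Gamma_objects =
     {U. subspace U \<and> dim U \<in> Gamma_types \<and> U \<inter> Rad UNIV = {0} \<and> dim (Rad U) \<le> 1}"

definition Gamma_inc :: "'v set \<Rightarrow> 'v set \<Rightarrow> bool" where
  "Gamma_inc X Y \<longleftrightarrow> X = Y
     \<or> dim X < dim Y \<and> X \<subseteq> Y \<and> X \<inter> Rad Y = {0}
     \<or> dim Y < dim X \<and> Y \<subseteq> X \<and> Y \<inter> Rad X = {0}"

end

end

theory Submission
  imports Defs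
begin

text \<open>
Call a subspace good if its radical is at most one-dimensional, and write \<open>X < Y\<close> for
\<open>below X Y\<close>: \<open>X\<close> is a proper subspace of \<open>Y\<close> and \<open>X \<inter> Y\<^sup>\<bottom> = 0\<close>. For \<open>X \<subseteq> Y\<close> the last
condition says \<open>X \<inter> Rad Y = 0\<close>; written with \<open>Y\<^sup>\<bottom>\<close> it makes the relation obviously transitive. The geometry
\<open>\<Gamma>(V)\<close> is the open interval between \<open>0\<close> and \<open>V\<close> of this order on the good subspaces, and the residue
of a flag is the join of the open intervals between consecutive members of \<open>0, F, V\<close>. A join of two
nonempty geometries is connected, and it is simply connected as soon as one of them is connected.
So everything follows once the interval between good \<open>X < Y\<close> is known to be nonempty, connected,
simply connected when \<open>dim Y - dim X\<close> is at least \<open>2\<close>, \<open>3\<close>, \<open>4\<close> (\<open>connectivity_level_flag_residue\<close>).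

Simple connectivity is proved in the language of coverings. A \<open>transport\<close> attaches a set to each
object and compatible bijections to the incident pairs; a geometry in which all transports have
flat sections through every element over some object has no nontrivial loops, as one sees from the
transport of homotopy classes of paths (\<open>simply_connected_if_transports_trivial\<close>).
In an interval a flat section is determined by its values on the points, the objects of
dimension \<open>dim X + 1\<close>, and it is carried from point to point along lines, the objects of dimension
\<open>dim X + 2\<close>. Three properties of the collinearity graph produce a section on the points: any three
points have a common neighbour; a quadrangle whose diagonals are not edges has a point adjacent
to all its vertices; every triangle either lies in an object or is the base of a tetrahedron
whose other faces do. The value at a point is transported from the base point through
any common neighbour (\<open>flat_section_if_common_neighbours\<close>).

It remains to verify the three properties. Splitting off a complement of \<open>Rad X\<close> in \<open>X\<close>, which is
nondegenerate, reduces to \<open>X = 0\<close> or \<open>X = \<langle>r\<rangle>\<close> inside a good space \<open>U\<close>.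
For \<open>X = 0\<close> the points are spanned by the vectors of \<open>U\<close> outside \<open>Rad U\<close>, and two of them are collinear iff
they are not orthogonal. A quadrangle \<open>a, y, x, z\<close> with orthogonal diagonals is coned off by \<open>a + y\<close>.
The other two properties ask for vectors not orthogonal to three given ones; these exist because a
vector space over a field with at least three elements is not the union of three hyperplanes.
For \<open>X = \<langle>r\<rangle>\<close> the points are \<open>\<langle>r, v\<rangle>\<close> with \<open>form r v = 1\<close>, and form an affine space modulo \<open>r\<close>; two of
them are collinear iff the difference of the vectors lies outside \<open>S = \<langle>r\<rangle> + Rad U\<close>, so that
non-collinearity is an equivalence relation and the first two properties only require to avoid cosets of
\<open>S\<close>. A triangle \<open>v, w, u\<close> lies in an object if \<open>form (w - v) (u - v) \<noteq> 0\<close>; otherwise it is coned off by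
\<open>v + c\<close> for a vector \<open>c\<close> orthogonal to \<open>r\<close> but to none of the three differences.
\<close>

section \<open>Homotopy of paths and flat sections\<close>

definition edge :: "'o set \<Rightarrow> ('o \<Rightarrow> 'o \<Rightarrow> bool) \<Rightarrow> 'o \<Rightarrow> 'o \<Rightarrow> bool" where
  "edge Ob inc x y \<longleftrightarrow> x \<in> Ob \<and> y \<in> Ob \<and> x \<noteq> y \<and> inc x y"

text \<open>A combinatorial covering: \<open>M x\<close> is the fibre over \<open>x\<close>, and \<open>T x y\<close> lifts the step from \<open>x\<close> to
  \<open>y\<close>. The laws for backtracking and for triangles are the two elementary homotopies, cycles
  of length 2 and 3.\<close>

locale transport =
  fixes Ob :: "'o set" and inc :: "'o \<Rightarrow> 'o \<Rightarrow> bool"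
    and M :: "'o \<Rightarrow> 'c set" and T :: "'o \<Rightarrow> 'o \<Rightarrow> 'c \<Rightarrow> 'c"
  assumes inc_sym: "edge Ob inc x y \<Longrightarrow> edge Ob inc y x"
    and T_closed: "edge Ob inc x y \<Longrightarrow> c \<in> M x \<Longrightarrow> T x y c \<in> M y"
    and T_back: "edge Ob inc x y \<Longrightarrow> c \<in> M x \<Longrightarrow> T y x (T x y c) = c"
    and T_triangle: "edge Ob inc x y \<Longrightarrow> edge Ob inc y z \<Longrightarrow> edge Ob inc x z \<Longrightarrow> c \<in> M x
      \<Longrightarrow> T y z (T x y c) = T x z c"

definition flat_section ::
  "'o set \<Rightarrow> ('o \<Rightarrow> 'o \<Rightarrow> bool) \<Rightarrow> ('o \<Rightarrow> 'c set) \<Rightarrow> ('o \<Rightarrow> 'o \<Rightarrow> 'c \<Rightarrow> 'c) \<Rightarrow> ('o \<Rightarrow> 'c) \<Rightarrow> bool" where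
  "flat_section Ob inc M T h \<longleftrightarrow>
     (\<forall>x\<in>Ob. h x \<in> M x) \<and> (\<forall>x y. edge Ob inc x y \<longrightarrow> h y = T x y (h x))"

text \<open>The fibres have the type of homotopy classes of paths because simple connectivity follows from the
  triviality of the transport on these classes.\<close>

definition trivial_transports :: "'o set \<Rightarrow> ('o \<Rightarrow> 'o \<Rightarrow> bool) \<Rightarrow> 'o \<Rightarrow> bool" where
  "trivial_transports Ob inc b \<longleftrightarrow> b \<in> Ob \<and>
     (\<forall>M T. transport Ob inc M (T :: 'o \<Rightarrow> 'o \<Rightarrow> 'o list set \<Rightarrow> 'o list set) \<longrightarrow>
        (\<forall>c\<in>M b. \<exists>h. flat_section Ob inc M T h \<and> h b = c))"

lemma inc_path_snoc:
  "inc_path Ob inc p \<Longrightarrow> edge Ob inc (last p) z \<Longrightarrow> inc_path Ob inc (p @ [z])"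
  by (auto simp: inc_path_def edge_def successively_append_iff)

lemma inc_path_snocD:
  assumes "inc_path Ob inc (p @ [z])" "p \<noteq> []"
  shows "inc_path Ob inc p" "edge Ob inc (last p) z"
proof -
  have "last p \<in> set p" using assms(2) by simp
  then show "inc_path Ob inc p" "edge Ob inc (last p) z"
    using assms by (auto simp: inc_path_def edge_def successively_append_iff)
qed

lemma inc_path_singleton [simp]: "inc_path Ob inc [x] \<longleftrightarrow> x \<in> Ob"
  by (auto simp: inc_path_def)

lemma inc_path_last: "inc_path Ob inc p \<Longrightarrow> last p \<in> Ob"
  by (auto simp: inc_path_def dest: last_in_set)

lemma cycle_insertionI:
  assumes "inc_path Ob inc (p @ vs)" "p \<noteq> []" "inc_cycle Ob inc (last p) (last p # cs)"
    and "length cs \<in> {2, 3}"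
  shows "cycle_insertion Ob inc (p @ vs) (p @ cs @ vs)"
proof -
  obtain us x where p: "p = us @ [x]" using assms(2) by (cases p rule: rev_cases) auto
  have "inc_path_length (x # cs) \<in> {2, 3}" using assms(4) by (simp add: inc_path_length_def)
  then show ?thesis
    using assms(1,3) unfolding cycle_insertion_def p
    by (intro conjI exI[of _ us] exI[of _ x] exI[of _ vs] exI[of _ "x # cs"]) simp_all
qed

lemma cycle_insertion_endpoints:
  assumes "cycle_insertion Ob inc p q"
  shows "inc_path Ob inc p" "inc_path Ob inc q" "hd q = hd p" "last q = last p"
proof -
  obtain us x vs c where p: "inc_path Ob inc p" and c: "inc_path Ob inc c" "hd c = x" "last c = x"
    and pq: "p = us @ [x] @ vs" "q = us @ c @ vs"
    using assms by (auto simp: cycle_insertion_def inc_cycle_def)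
  have "c \<noteq> []" using c by (simp add: inc_path_def)
  show "inc_path Ob inc p" by (rule p)
  show "inc_path Ob inc q" "hd q = hd p" "last q = last p"
    using p c pq \<open>c \<noteq> []\<close>
    by (auto simp: inc_path_def successively_append_iff successively_Cons hd_append last_append)
qed

lemma cycle_insertion_snoc:
  assumes "cycle_insertion Ob inc p q" "edge Ob inc (last p) z"
  shows "cycle_insertion Ob inc (p @ [z]) (q @ [z])"
proof -
  obtain us x vs c where "inc_cycle Ob inc x c" "inc_path_length c \<in> {2, 3}"
    "p = us @ [x] @ vs" "q = us @ c @ vs"
    using assms(1) by (auto simp: cycle_insertion_def)
  moreover have "inc_path Ob inc (p @ [z])"
    using inc_path_snoc assms cycle_insertion_endpoints(1) by metis
  ultimately show ?thesis unfolding cycle_insertion_def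
    by (intro conjI exI[of _ us] exI[of _ x] exI[of _ "vs @ [z]"] exI[of _ c]) auto
qed

lemma inc_homotopic_refl [simp]: "inc_homotopic Ob inc p p"
  by (simp add: inc_homotopic_def equivclp_def)

lemma inc_homotopic_sym: "inc_homotopic Ob inc p q \<Longrightarrow> inc_homotopic Ob inc q p"
  by (simp add: inc_homotopic_def equivclp_sym)

lemma inc_homotopic_trans:
  "inc_homotopic Ob inc p q \<Longrightarrow> inc_homotopic Ob inc q r \<Longrightarrow> inc_homotopic Ob inc p r"
  unfolding inc_homotopic_def by (rule transpD[OF transp_equivclp])

lemma inc_homotopic_insertion: "cycle_insertion Ob inc p q \<Longrightarrow> inc_homotopic Ob inc p q"
  unfolding inc_homotopic_def equivclp_def by (simp add: r_into_rtranclp symclpI)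

lemma inc_homotopic_endpoints:
  assumes "inc_homotopic Ob inc p q" "inc_path Ob inc p"
  shows "inc_path Ob inc q \<and> hd q = hd p \<and> last q = last p"
  using assms(1) unfolding inc_homotopic_def
proof (induction rule: equivclp_induct)
  case base
  then show ?case using assms(2) by simp
next
  case (step y z)
  then show ?case using cycle_insertion_endpoints by metis
qed

lemma inc_homotopic_snoc:
  assumes "inc_homotopic Ob inc p q" "inc_path Ob inc p" "edge Ob inc (last p) z"
  shows "inc_homotopic Ob inc (p @ [z]) (q @ [z])"
  using assms(1) unfolding inc_homotopic_def
proof (induction rule: equivclp_induct)
  case base
  then show ?case by (simp add: equivclp_def)
next
  case (step x y)
  have "last x = last p" "last y = last p"
    using step(1,2) assms(2) inc_homotopic_endpoints cycle_insertion_endpoints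
    unfolding inc_homotopic_def by metis+
  then have "inc_homotopic Ob inc (x @ [z]) (y @ [z])"
    using step(2) assms(3) inc_homotopic_insertion inc_homotopic_sym cycle_insertion_snoc by metis
  then show ?case using step(3) inc_homotopic_trans unfolding inc_homotopic_def by metis
qed

lemma backtrack_homotopic:
  assumes "inc_path Ob inc p" "edge Ob inc (last p) z" "edge Ob inc z (last p)"
  shows "inc_homotopic Ob inc p (p @ [z, last p])"
proof (rule inc_homotopic_insertion)
  have "p \<noteq> []" using assms(1) by (simp add: inc_path_def)
  moreover have "inc_cycle Ob inc (last p) [last p, z, last p]"
    using assms by (auto simp: inc_cycle_def inc_path_def edge_def)
  ultimately show "cycle_insertion Ob inc p (p @ [z, last p])"
    using cycle_insertionI[of Ob inc p "[]" "[z, last p]"] assms(1) by simp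
qed

text \<open>Both paths become \<open>p, y, z, last p, z\<close> by an insertion: of the triangle through \<open>y\<close> and \<open>z\<close> at
  the end of \<open>p\<close>, and of a backtracking step at \<open>z\<close>.\<close>

lemma triangle_homotopic:
  assumes "inc_path Ob inc p" and e: "edge Ob inc (last p) y" "edge Ob inc y z" "edge Ob inc (last p) z"
    and e': "edge Ob inc z (last p)"
  shows "inc_homotopic Ob inc (p @ [y, z]) (p @ [z])"
proof -
  have "p \<noteq> []" using assms(1) by (simp add: inc_path_def)
  have path: "inc_path Ob inc (p @ [y, z])" "inc_path Ob inc (p @ [z])"
    using inc_path_snoc[OF inc_path_snoc[OF assms(1) e(1)], of z] inc_path_snoc[OF assms(1) e(3)] e(2)
    by simp_all
  have "inc_cycle Ob inc (last p) [last p, y, z, last p]" "inc_cycle Ob inc z [z, last p, z]"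
    using e e' by (auto simp: inc_cycle_def inc_path_def edge_def)
  then have "cycle_insertion Ob inc (p @ [z]) (p @ [y, z, last p, z])"
    and "cycle_insertion Ob inc (p @ [y, z]) (p @ [y, z, last p, z])"
    using cycle_insertionI[of Ob inc p "[z]" "[y, z, last p]"]
      cycle_insertionI[of Ob inc "p @ [y, z]" "[]" "[last p, z]"] path \<open>p \<noteq> []\<close>
    by simp_all
  then show ?thesis
    using inc_homotopic_insertion inc_homotopic_sym inc_homotopic_trans by metis
qed

definition homotopy_class :: "'o set \<Rightarrow> ('o \<Rightarrow> 'o \<Rightarrow> bool) \<Rightarrow> 'o list \<Rightarrow> 'o list set" where
  "homotopy_class Ob inc p = {q. inc_homotopic Ob inc p q}"

lemma homotopy_class_eq_iff:
  "homotopy_class Ob inc p = homotopy_class Ob inc q \<longleftrightarrow> inc_homotopic Ob inc p q"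
proof
  assume "homotopy_class Ob inc p = homotopy_class Ob inc q"
  moreover have "q \<in> homotopy_class Ob inc q" by (simp add: homotopy_class_def)
  ultimately show "inc_homotopic Ob inc p q" by (auto simp: homotopy_class_def)
next
  assume "inc_homotopic Ob inc p q"
  then show "homotopy_class Ob inc p = homotopy_class Ob inc q"
    unfolding homotopy_class_def using inc_homotopic_sym inc_homotopic_trans by blast
qed

definition path_fibre :: "'o set \<Rightarrow> ('o \<Rightarrow> 'o \<Rightarrow> bool) \<Rightarrow> 'o \<Rightarrow> 'o \<Rightarrow> 'o list set set" where
  "path_fibre Ob inc b x =
     homotopy_class Ob inc ` {p. inc_path Ob inc p \<and> hd p = b \<and> last p = x}"

text \<open>The universal covering: the fibre over \<open>x\<close> consists of the homotopy classes of paths from the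
  base point to \<open>x\<close>, and a step appends its end to an arbitrary representative.\<close>

definition path_extension ::
  "'o set \<Rightarrow> ('o \<Rightarrow> 'o \<Rightarrow> bool) \<Rightarrow> 'o \<Rightarrow> 'o \<Rightarrow> 'o list set \<Rightarrow> 'o list set" where
  "path_extension Ob inc x y C =
     homotopy_class Ob inc ((SOME p. inc_path Ob inc p \<and> homotopy_class Ob inc p = C) @ [y])"

lemma path_extension_class:
  assumes "inc_path Ob inc p" "edge Ob inc (last p) y"
  shows "path_extension Ob inc (last p) y (homotopy_class Ob inc p) = homotopy_class Ob inc (p @ [y])"
proof -
  define q where
    "q = (SOME q. inc_path Ob inc q \<and> homotopy_class Ob inc q = homotopy_class Ob inc p)"
  have "inc_path Ob inc q \<and> homotopy_class Ob inc q = homotopy_class Ob inc p"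
    unfolding q_def by (rule someI[of _ p]) (simp add: assms)
  then have "inc_homotopic Ob inc p q"
    by (metis homotopy_class_eq_iff)
  then have "inc_homotopic Ob inc (p @ [y]) (q @ [y])" by (rule inc_homotopic_snoc) (fact assms)+
  then show ?thesis unfolding path_extension_def q_def[symmetric]
    by (metis homotopy_class_eq_iff)
qed

text \<open>The two laws of a transport hold here by \<open>backtrack_homotopic\<close> and \<open>triangle_homotopic\<close>.\<close>

lemma transport_paths:
  assumes sym: "\<And>x y. edge Ob inc x y \<Longrightarrow> edge Ob inc y x"
  shows "transport Ob inc (path_fibre Ob inc b) (path_extension Ob inc)"
proof
  fix x y c
  assume e: "edge Ob inc x y" and "c \<in> path_fibre Ob inc b x"
  then obtain p where p: "inc_path Ob inc p" "hd p = b" "last p = x" "c = homotopy_class Ob inc p"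
    by (auto simp: path_fibre_def)
  have xy: "path_extension Ob inc x y c = homotopy_class Ob inc (p @ [y])"
    using path_extension_class[of Ob inc p y] p e by simp
  have py: "inc_path Ob inc (p @ [y])" using inc_path_snoc[of Ob inc p y] p e by simp
  then show "path_extension Ob inc x y c \<in> path_fibre Ob inc b y"
    unfolding path_fibre_def xy using p(1,2)
    by (intro imageI CollectI) (auto simp: hd_append inc_path_def)
  have "path_extension Ob inc y x (path_extension Ob inc x y c) = homotopy_class Ob inc (p @ [y, x])"
    using path_extension_class[of Ob inc "p @ [y]" x] py sym[OF e] xy by simp
  also have "\<dots> = c"
    using backtrack_homotopic[of Ob inc p y] p e sym[OF e] homotopy_class_eq_iff[of Ob inc p] by metis
  finally show "path_extension Ob inc y x (path_extension Ob inc x y c) = c" .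
  fix z assume e': "edge Ob inc y z" "edge Ob inc x z"
  have "path_extension Ob inc y z (path_extension Ob inc x y c) = homotopy_class Ob inc (p @ [y, z])"
    using path_extension_class[of Ob inc "p @ [y]" z] py e' xy by simp
  also have "\<dots> = homotopy_class Ob inc (p @ [z])"
    using triangle_homotopic[of Ob inc p y z] p e e' sym[of x z]
      homotopy_class_eq_iff[of Ob inc "p @ [y, z]"] by simp
  also have "\<dots> = path_extension Ob inc x z c"
    using path_extension_class[of Ob inc p z] p e' by simp
  finally show "path_extension Ob inc y z (path_extension Ob inc x y c) = path_extension Ob inc x z c" .
qed (fact sym)

lemma flat_section_path_class:
  assumes h: "flat_section Ob inc (path_fibre Ob inc b) (path_extension Ob inc) h"
    and b: "h b = homotopy_class Ob inc [b]"
    and p: "inc_path Ob inc p" "hd p = b"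
  shows "homotopy_class Ob inc p = h (last p)"
  using p
proof (induction p rule: rev_induct)
  case Nil
  then show ?case by (simp add: inc_path_def)
next
  case (snoc z p)
  show ?case
  proof (cases "p = []")
    case True
    then show ?thesis using snoc b by simp
  next
    case False
    then have "inc_path Ob inc p" "edge Ob inc (last p) z" "hd p = b"
      using inc_path_snocD snoc.prems by (metis, metis, simp)
    then show ?thesis
      using snoc.IH path_extension_class[of Ob inc p z] h by (simp add: flat_section_def)
  qed
qed

text \<open>Flat sections through every element over one object give the same over any object joined to it: lift
  the path, and take the section through the end of the lift.\<close>

lemma (in transport) flat_section_along_path:
  assumes "inc_path Ob inc p"
    and "\<forall>c\<in>M (last p). \<exists>h. flat_section Ob inc M T h \<and> h (last p) = c"
  shows "\<forall>c\<in>M (hd p). \<exists>h. flat_section Ob inc M T h \<and> h (hd p) = c"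
  using assms
proof (induction p)
  case Nil
  then show ?case by (simp add: inc_path_def)
next
  case (Cons x p)
  show ?case
  proof (cases "p = []")
    case True
    then show ?thesis using Cons by simp
  next
    case False
    then have p: "inc_path Ob inc p" and e: "edge Ob inc x (hd p)"
      using Cons.prems(1) by (auto simp: inc_path_def edge_def successively_Cons)
    have IH: "\<forall>c\<in>M (hd p). \<exists>h. flat_section Ob inc M T h \<and> h (hd p) = c"
      using Cons.IH[OF p] Cons.prems(2) False by simp
    show ?thesis
    proof
      fix c assume "c \<in> M (hd (x # p))"
      then have c: "c \<in> M x" by simp
      then obtain h where h: "flat_section Ob inc M T h" "h (hd p) = T x (hd p) c"
        using IH T_closed[OF e] by blast
      then have "h x = c"
        using inc_sym[OF e] T_back[OF e c] by (simp add: flat_section_def)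
      then show "\<exists>h. flat_section Ob inc M T h \<and> h (hd (x # p)) = c" using h by auto
    qed
  qed
qed

text \<open>In the universal covering based at \<open>x\<close>, a flat section starting at the class of the trivial path has
  at the end of any path the class of that path. For a closed path both ends are
  the same object, so the path has the class of the trivial one.\<close>

theorem simply_connected_if_transports_trivial:
  assumes sym: "\<And>x y. edge Ob inc x y \<Longrightarrow> edge Ob inc y x"
    and conn: "inc_connected Ob inc"
    and triv: "trivial_transports Ob inc b"
  shows "inc_simply_connected Ob inc"
  unfolding inc_simply_connected_def
proof (intro conjI allI impI conn)
  fix x c assume c: "inc_cycle Ob inc x c"
  have cp: "inc_path Ob inc c" "hd c = x" "last c = x" using c by (auto simp: inc_cycle_def)
  then have x: "x \<in> Ob" using inc_path_last by metis
  interpret transport Ob inc "path_fibre Ob inc x" "path_extension Ob inc"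
    by (rule transport_paths) (fact sym)
  obtain q where q: "inc_path Ob inc q" "hd q = x" "last q = b"
    using conn triv x unfolding inc_connected_def trivial_transports_def by blast
  have "\<forall>c\<in>path_fibre Ob inc x b.
      \<exists>h. flat_section Ob inc (path_fibre Ob inc x) (path_extension Ob inc) h \<and> h b = c"
    using triv transport_axioms unfolding trivial_transports_def by blast
  moreover have "homotopy_class Ob inc [x] \<in> path_fibre Ob inc x x"
    using x by (auto simp: path_fibre_def)
  ultimately obtain h where
    h: "flat_section Ob inc (path_fibre Ob inc x) (path_extension Ob inc) h"
      "h x = homotopy_class Ob inc [x]"
    using flat_section_along_path[OF q(1)] q(2,3) by auto
  have "homotopy_class Ob inc c = homotopy_class Ob inc [x]"
    using flat_section_path_class[OF h cp(1,2)] cp(3) h(2) by simp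
  then have "inc_homotopic Ob inc c [x]" by (simp add: homotopy_class_eq_iff)
  moreover have "inc_cycle Ob inc x [x]" using x by (simp add: inc_cycle_def)
  ultimately show "\<exists>y d. inc_cycle Ob inc y d \<and> inc_path_length d = 0 \<and> inc_homotopic Ob inc c d"
    by (intro exI[of _ x] exI[of _ "[x]"]) (simp add: inc_path_length_def)
qed

section \<open>Connectedness and joins of geometries\<close>

lemma inc_connected_step:
  assumes "Ob \<noteq> {}" "b \<in> Ob" "\<And>x. x \<in> Ob \<Longrightarrow> (edge Ob inc)\<^sup>*\<^sup>* b x"
    and sym: "\<And>x y. edge Ob inc x y \<Longrightarrow> edge Ob inc y x"
  shows "inc_connected Ob inc"
proof -
  have path: "\<exists>p. inc_path Ob inc p \<and> hd p = x \<and> last p = y"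
    if "(edge Ob inc)\<^sup>*\<^sup>* x y" "x \<in> Ob" for x y
    using that
  proof (induction rule: rtranclp_induct)
    case base
    then show ?case by (intro exI[of _ "[x]"]) simp
  next
    case (step y z)
    then obtain p where p: "inc_path Ob inc p" "hd p = x" "last p = y" by blast
    then have "inc_path Ob inc (p @ [z])" using inc_path_snoc step(2) by metis
    then show ?case using p by (intro exI[of _ "p @ [z]"]) (auto simp: inc_path_def hd_append)
  qed
  have "symp (edge Ob inc)" by (rule sympI) (rule sym)
  then have "symp (edge Ob inc)\<^sup>*\<^sup>*" by (rule symp_rtranclp)
  then have "(edge Ob inc)\<^sup>*\<^sup>* x y" if "x \<in> Ob" "y \<in> Ob" for x y
    using assms(3)[OF that(1)] assms(3)[OF that(2)] by (meson rtranclp_trans sympD)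
  then show ?thesis unfolding inc_connected_def using path assms(1) by simp
qed

lemma inc_connected_reach:
  assumes "inc_connected Ob inc" "x \<in> Ob" "y \<in> Ob"
  shows "(edge Ob inc)\<^sup>*\<^sup>* x y"
proof -
  have "inc_path Ob inc p \<Longrightarrow> (edge Ob inc)\<^sup>*\<^sup>* (hd p) (last p)" for p
  proof (induction p rule: rev_induct)
    case (snoc z p)
    show ?case
    proof (cases "p = []")
      case False
      then show ?thesis using snoc inc_path_snocD[of Ob inc p z] by (simp add: hd_append)
    qed simp
  qed (simp add: inc_path_def)
  moreover obtain p where "inc_path Ob inc p" "hd p = x" "last p = y"
    using assms unfolding inc_connected_def by blast
  ultimately show ?thesis by metis
qed

locale geometry_join =
  fixes A B :: "'o set" and inc :: "'o \<Rightarrow> 'o \<Rightarrow> bool"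
  assumes disjoint: "A \<inter> B = {}"
    and inc_AB: "a \<in> A \<Longrightarrow> b \<in> B \<Longrightarrow> inc a b"
    and inc_BA: "a \<in> A \<Longrightarrow> b \<in> B \<Longrightarrow> inc b a"
    and sym: "edge (A \<union> B) inc x y \<Longrightarrow> edge (A \<union> B) inc y x"
begin

lemma edge_AB: "a \<in> A \<Longrightarrow> b \<in> B \<Longrightarrow> edge (A \<union> B) inc a b \<and> edge (A \<union> B) inc b a"
  using disjoint inc_AB inc_BA by (auto simp: edge_def)

lemma edge_A: "edge A inc x y \<Longrightarrow> edge (A \<union> B) inc x y"
  by (simp add: edge_def)

lemma join_connected:
  assumes "a \<in> A" "b \<in> B"
  shows "inc_connected (A \<union> B) inc"
proof (rule inc_connected_step[of _ a])
  show "(edge (A \<union> B) inc)\<^sup>*\<^sup>* a x" if "x \<in> A \<union> B" for x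
  proof (cases "x \<in> A")
    case True
    then show ?thesis
      using edge_AB[OF \<open>a \<in> A\<close> \<open>b \<in> B\<close>] edge_AB[OF True \<open>b \<in> B\<close>]
      by (meson r_into_rtranclp rtranclp.rtrancl_into_rtrancl)
  next
    case False
    then show ?thesis using edge_AB \<open>a \<in> A\<close> that by blast
  qed
qed (use assms sym in auto)

text \<open>Start at \<open>b \<in> B\<close>: the values on \<open>A\<close> are forced, and they are flat because \<open>b\<close> cones off all
  edges of \<open>A\<close>. The values on \<open>B\<close> are transported from an object \<open>a\<close> of \<open>A\<close>; connectedness of \<open>A\<close> makes
  them independent of \<open>a\<close>.\<close>

lemma join_flat_section:
  assumes conn: "inc_connected A inc" and b: "b \<in> B"
    and "transport (A \<union> B) inc M T" and c: "c \<in> M b"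
  shows "\<exists>h. flat_section (A \<union> B) inc M T h \<and> h b = c"
proof -
  interpret transport "A \<union> B" inc M T by fact
  obtain a where a: "a \<in> A" using conn by (auto simp: inc_connected_def)
  define h where "h = (\<lambda>x. if x \<in> A then T b x c else T a x (T b a c))"
  have hA: "h x = T b x c" "h x \<in> M x" if "x \<in> A" for x
    using that edge_AB[OF that b] T_closed c by (auto simp: h_def)
  have A_flat: "h y = T x y (h x)" if "edge A inc x y" for x y
    using that T_triangle[of b x y c] edge_AB b c edge_A[OF that] hA by (auto simp: edge_def)
  have hB: "h y = T x y (h x)" "h y \<in> M y" if x: "x \<in> A" and y: "y \<in> B" for x y
  proof -
    have "(edge A inc)\<^sup>*\<^sup>* a x" using inc_connected_reach conn a x by metis
    then have "x \<in> A \<and> T x y (h x) = T a y (h a)"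
    proof (induction rule: rtranclp_induct)
      case base
      then show ?case using a by simp
    next
      case (step u v)
      then have uv: "edge A inc u v" "u \<in> A" "v \<in> A" by (auto simp: edge_def)
      have "T v y (h v) = T v y (T u v (h u))" using A_flat uv by simp
      also have "\<dots> = T u y (h u)"
        using T_triangle[of u v y "h u"] edge_A[OF uv(1)] edge_AB uv y hA(2) by blast
      finally show ?case using step uv by simp
    qed
    moreover have "h y = T a y (h a)" using y disjoint hA(1)[OF a] by (auto simp: h_def)
    ultimately show "h y = T x y (h x)" "h y \<in> M y"
      using T_closed[of x y "h x"] edge_AB[OF x y] hA(2)[OF x] by simp_all
  qed
  have "h y = T x y (h x)" if e: "edge (A \<union> B) inc x y" for x y
  proof -
    consider "x \<in> A" "y \<in> A" | "x \<in> A" "y \<in> B" | "x \<in> B" "y \<in> A" | "x \<in> B" "y \<in> B"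
      using e by (auto simp: edge_def)
    then show ?thesis
    proof cases
      case 1
      then show ?thesis using A_flat e by (simp add: edge_def)
    next
      case 2
      then show ?thesis using hB by simp
    next
      case 3
      then show ?thesis using hB(1)[OF 3(2,1)] T_back[of y x "h y"] edge_AB[OF 3(2,1)] hA(2)[OF 3(2)] by simp
    next
      case 4
      have "T x y (T a x (h a)) = T a y (h a)"
        using T_triangle[of a x y "h a"] edge_AB a 4 e hA(2)[OF a] by blast
      then show ?thesis using hB[OF a 4(1)] hB[OF a 4(2)] by simp
    qed
  qed
  moreover have "\<forall>x\<in>A \<union> B. h x \<in> M x" using hA hB a by blast
  moreover have "h b = c"
    using hB(1)[OF a b] hA(1)[OF a] T_back edge_AB[OF a b] c by simp
  ultimately show ?thesis unfolding flat_section_def by blast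
qed

lemma join_trivial_transports:
  assumes "inc_connected A inc" "b \<in> B"
  shows "trivial_transports (A \<union> B) inc b"
  unfolding trivial_transports_def
  by (intro conjI allI impI ballI join_flat_section) (use assms in auto)

end

text \<open>For \<open>k \<le> 3\<close> this amounts to the flag complex being \<open>(k - 2)\<close>-connected; the grading makes the behaviour
  under joins additive.\<close>

definition connectivity_level :: "nat \<Rightarrow> 'o set \<Rightarrow> ('o \<Rightarrow> 'o \<Rightarrow> bool) \<Rightarrow> bool" where
  "connectivity_level k Ob inc \<longleftrightarrow> (1 \<le> k \<longrightarrow> Ob \<noteq> {}) \<and> (2 \<le> k \<longrightarrow> inc_connected Ob inc)
     \<and> (3 \<le> k \<longrightarrow> (\<exists>b. trivial_transports Ob inc b))"

lemma geometry_join_commute: "geometry_join A B inc \<Longrightarrow> geometry_join B A inc"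
  unfolding geometry_join_def by (auto simp: Un_commute)

lemma connectivity_level_join:
  assumes "geometry_join A B inc" and A: "connectivity_level i A inc" and B: "connectivity_level j B inc"
    and k: "k \<le> i + j"
  shows "connectivity_level k (A \<union> B) inc"
proof -
  interpret AB: geometry_join A B inc by fact
  interpret BA: geometry_join B A inc by (rule geometry_join_commute) fact
  consider "A = {}" | "B = {}" | "A \<noteq> {}" "B \<noteq> {}" by blast
  then show ?thesis
  proof cases
    case 1
    then have "i = 0" using A by (auto simp: connectivity_level_def)
    then show ?thesis using 1 B k by (auto simp: connectivity_level_def)
  next
    case 2
    then have "j = 0" using B by (auto simp: connectivity_level_def)
    then show ?thesis using 2 A k by (auto simp: connectivity_level_def)
  next
    case 3
    then obtain a b where ab: "a \<in> A" "b \<in> B" by blast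
    have "\<exists>b. trivial_transports (A \<union> B) inc b" if "3 \<le> k"
    proof -
      have "2 \<le> i \<or> 2 \<le> j" using k \<open>3 \<le> k\<close> by linarith
      then consider "2 \<le> i" | "2 \<le> j" by blast
      then show ?thesis
      proof cases
        case 1
        then have "inc_connected A inc" using A by (simp add: connectivity_level_def)
        then show ?thesis using AB.join_trivial_transports ab(2) by blast
      next
        case 2
        then have "inc_connected B inc" using B by (simp add: connectivity_level_def)
        then have "trivial_transports (B \<union> A) inc a" using BA.join_trivial_transports ab(1) by blast
        then show ?thesis by (auto simp: Un_commute)
      qed
    qed
    then show ?thesis using AB.join_connected[OF ab] ab by (auto simp: connectivity_level_def)
  qed
qed

section \<open>Residues of flags in ranked geometries\<close>

definition incident :: "('o \<Rightarrow> 'o \<Rightarrow> bool) \<Rightarrow> 'o \<Rightarrow> 'o \<Rightarrow> bool" where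
  "incident lt x y \<longleftrightarrow> x = y \<or> lt x y \<or> lt y x"

text \<open>The relation \<open>lt\<close> is a strict order, but of subspaces with additional conditions rather than their
  inclusion, so it is kept abstract.\<close>

locale ranked_geometry =
  fixes G :: "'o set" and lt :: "'o \<Rightarrow> 'o \<Rightarrow> bool" and rk :: "'o \<Rightarrow> nat"
  assumes lt_trans: "x \<in> G \<Longrightarrow> y \<in> G \<Longrightarrow> z \<in> G \<Longrightarrow> lt x y \<Longrightarrow> lt y z \<Longrightarrow> lt x z"
    and lt_rank: "x \<in> G \<Longrightarrow> y \<in> G \<Longrightarrow> lt x y \<Longrightarrow> rk x < rk y"
begin

definition between :: "'o \<Rightarrow> 'o \<Rightarrow> 'o set" where
  "between x y = {z \<in> G. lt x z \<and> lt z y}"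

lemma edge_sym: "edge Ob (incident lt) x y \<Longrightarrow> edge Ob (incident lt) y x"
  by (auto simp: edge_def incident_def)

text \<open>By induction on the flag. If \<open>u\<close> is its largest member, the residue is the join of the residue of the
  smaller flag below \<open>u\<close> with the interval above \<open>u\<close>.\<close>

theorem connectivity_level_flag_residue:
  assumes intervals: "\<And>x y. x \<in> G \<Longrightarrow> y \<in> G \<Longrightarrow> lt x y \<Longrightarrow>
      connectivity_level (rk y - rk x - 1) (between x y) (incident lt)"
    and "x \<in> G" "y \<in> G" "lt x y" "finite F" "flag (between x y) (incident lt) F"
  shows "connectivity_level (rk y - rk x - 1 - card F) (flag_residue (between x y) (incident lt) F) (incident lt)"
  using assms(5,3,4,6)
proof (induction "card F" arbitrary: F y)
  case 0
  then show ?case using intervals[OF \<open>x \<in> G\<close>] by (simp add: flag_residue_def)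
next
  case (Suc n)
  have fin: "finite (rk ` F)" "rk ` F \<noteq> {}" using Suc by auto
  obtain u where u: "u \<in> F" "rk u = Max (rk ` F)" using Max_in[OF fin] by auto
  have max: "rk v \<le> rk u" if "v \<in> F" for v using u that Suc.prems(1) by simp
  have FG: "v \<in> G" "lt x v" "lt v y" if "v \<in> F" for v
    using Suc.prems that by (auto simp: flag_def between_def)
  have below_u: "lt v u" if "v \<in> F - {u}" for v
  proof -
    have "incident lt v u" using Suc.prems u that by (auto simp: flag_def)
    moreover have "\<not> lt u v" using lt_rank[of u v] FG u that max[of v] by force
    ultimately show ?thesis using that by (auto simp: incident_def)
  qed
  define F' where "F' = F - {u}"
  define A where "A = flag_residue (between x u) (incident lt) F'"
  have "card F' = n" "finite F'" using Suc.hyps(2) Suc.prems(1) u by (auto simp: F'_def)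
  moreover have "flag (between x u) (incident lt) F'"
    using Suc.prems below_u FG by (auto simp: flag_def F'_def between_def)
  ultimately have A: "connectivity_level (rk u - rk x - 1 - card F') A (incident lt)"
    unfolding A_def using Suc.hyps(1)[of F' u] FG[OF u(1)] by simp
  have B: "connectivity_level (rk y - rk u - 1) (between u y) (incident lt)"
    using intervals FG[OF u(1)] Suc.prems by simp
  have "flag_residue (between x y) (incident lt) F = A \<union> between u y"
  proof (rule Set.set_eqI, rule iffI)
    fix z assume z: "z \<in> flag_residue (between x y) (incident lt) F"
    then have zG: "z \<in> G" "lt x z" "lt z y" "z \<notin> F" "\<forall>v\<in>F. incident lt z v"
      by (auto simp: flag_residue_def between_def)
    then have "lt z u \<or> lt u z" using u by (auto simp: incident_def)
    then show "z \<in> A \<union> between u y"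
      using zG by (auto simp: A_def F'_def flag_residue_def between_def)
  next
    fix z assume "z \<in> A \<union> between u y"
    then show "z \<in> flag_residue (between x y) (incident lt) F"
    proof
      assume "z \<in> A"
      then have z: "z \<in> G" "lt x z" "lt z u" "z \<notin> F'" "\<forall>v\<in>F'. incident lt z v"
        by (auto simp: flag_residue_def between_def A_def)
      then have "z \<noteq> u" "lt z y"
        using lt_rank[of u u] lt_trans[of z u y] FG[OF u(1)] Suc.prems by auto
      then show ?thesis using z
        by (auto simp: F'_def flag_residue_def between_def incident_def)
    next
      assume z: "z \<in> between u y"
      then have "lt v z" if "v \<in> F" for v
        using lt_trans[of v u z] below_u[of v] FG that u by (auto simp: between_def)
      moreover from this have "z \<notin> F" using lt_rank[of z z] z by (auto simp: between_def)
      moreover have "lt x z"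
        using z lt_trans[of x u z] FG[OF u(1)] \<open>x \<in> G\<close> by (auto simp: between_def)
      ultimately show ?thesis using z by (auto simp: flag_residue_def between_def incident_def)
    qed
  qed
  moreover have "geometry_join A (between u y) (incident lt)"
  proof
    have lt: "lt a b" if "a \<in> A" "b \<in> between u y" for a b
      using that lt_trans[of a u b] FG[OF u(1)]
      by (auto simp: A_def flag_residue_def between_def)
    then show "incident lt a b" "incident lt b a" if "a \<in> A" "b \<in> between u y" for a b
      using that by (auto simp: incident_def)
    show "A \<inter> between u y = {}"
      using lt lt_rank by (fastforce simp: between_def)
  qed (rule edge_sym)
  moreover have "rk y - rk x - 1 - card F \<le> (rk u - rk x - 1 - card F') + (rk y - rk u - 1)"
  proof -
    have "card F = Suc (card F')" using Suc.hyps(2) \<open>card F' = n\<close> by simp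
    moreover have "rk u < rk y" "rk x < rk u"
      using lt_rank FG[OF u(1)] Suc.prems(2) \<open>x \<in> G\<close> by blast+
    ultimately show ?thesis by linarith
  qed
  ultimately show ?case using connectivity_level_join[OF _ A B] by simp
qed

end

section \<open>Simple connectivity of an interval from its points and lines\<close>

text \<open>The value at \<open>x\<close> is transported from \<open>b\<close> through a common neighbour of \<open>b\<close> and \<open>x\<close>. Two such neighbours \<open>y\<close>, \<open>z\<close>
  give the same value, since the quadrangle \<open>b, y, x, z\<close> has a diagonal or a cone point and so
  decomposes into triangles. Flatness on an edge follows by using
  one common neighbour of \<open>b\<close> and both ends.\<close>

theorem flat_section_if_common_neighbours:
  assumes "transport P adj M t"
    and three: "\<And>x y z. x \<in> P \<Longrightarrow> y \<in> P \<Longrightarrow> z \<in> P \<Longrightarrow>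
      \<exists>s. edge P adj s x \<and> edge P adj s y \<and> edge P adj s z"
    and square: "\<And>a x y z. edge P adj a y \<Longrightarrow> edge P adj y x \<Longrightarrow> edge P adj a z \<Longrightarrow> edge P adj z x
      \<Longrightarrow> \<not> edge P adj a x \<Longrightarrow> \<not> edge P adj y z
      \<Longrightarrow> \<exists>s. edge P adj s a \<and> edge P adj s x \<and> edge P adj s y \<and> edge P adj s z"
    and b: "b \<in> P" and c: "c \<in> M b"
  shows "\<exists>h. flat_section P adj M t h \<and> h b = c"
proof -
  interpret transport P adj M t by fact
  let ?E = "edge P adj"
  note sym = inc_sym
  have indep: "t y x (t b y c) = t z x (t b z c)"
    if e: "?E b y" "?E y x" "?E b z" "?E z x" for x y z
  proof (cases "?E b x")
    case True
    then show ?thesis using T_triangle e c by simp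
  next
    case not_bx: False
    have adjacent: "t u x (t b u c) = t v x (t b v c)"
      if "?E b u" "?E u x" "?E b v" "?E v x" "?E u v" for u v
    proof -
      have "t u x (t b u c) = t v x (t u v (t b u c))"
        using T_triangle[of u v x "t b u c"] T_closed[of b u c] that c by simp
      then show ?thesis using T_triangle[of b u v c] that c by simp
    qed
    show ?thesis
    proof (cases "?E y z")
      case True
      then show ?thesis using adjacent e by blast
    next
      case False
      obtain s where s: "?E s b" "?E s x" "?E s y" "?E s z"
        using square[OF e not_bx False] by blast
      have "t y x (t b y c) = t s x (t b s c)" using adjacent[OF e(1,2) sym s(2) sym] s by simp
      also have "\<dots> = t z x (t b z c)" using adjacent[OF sym s(2) e(3,4) s(4)] s by simp
      finally show ?thesis .
    qed
  qed
  define via where "via x = (SOME y. ?E y b \<and> ?E y x)" for x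
  have via: "?E (via x) b" "?E (via x) x" if "x \<in> P" for x
  proof -
    have "\<exists>y. ?E y b \<and> ?E y x" using three[OF b b that] by blast
    then have "?E (via x) b \<and> ?E (via x) x" unfolding via_def by (rule someI_ex)
    then show "?E (via x) b" "?E (via x) x" by auto
  qed
  define h where "h x = t (via x) x (t b (via x) c)" for x
  have h: "h x = t y x (t b y c)" if "?E y b" "?E y x" for x y
  proof -
    have "x \<in> P" using that by (simp add: edge_def)
    then show ?thesis
      unfolding h_def using indep[OF sym[OF via(1)] via(2) sym[OF that(1)] that(2)] by simp
  qed
  have hM: "h x \<in> M x" if "x \<in> P" for x
    unfolding h_def using T_closed via[OF that] sym c by simp
  have "h x' = t x x' (h x)" if "?E x x'" for x x'
  proof -
    have "x \<in> P" "x' \<in> P" using that by (auto simp: edge_def)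
    then obtain y where y: "?E y b" "?E y x" "?E y x'" using three[OF b, of x x'] by blast
    then show ?thesis
      using h T_triangle[of y x x' "t b y c"] T_closed[of b y c] sym[OF y(1)] that c by simp
  qed
  moreover have "h b = c"
    unfolding h_def using T_back[OF sym[OF via(1)[OF b]] c] .
  ultimately show ?thesis unfolding flat_section_def using hM by blast
qed

text \<open>In an interval the objects of the lowest rank \<open>k\<close> serve as points and those of rank \<open>k + 1\<close> as lines.\<close>

definition line_through ::
  "'o set \<Rightarrow> ('o \<Rightarrow> 'o \<Rightarrow> bool) \<Rightarrow> ('o \<Rightarrow> nat) \<Rightarrow> nat \<Rightarrow> 'o \<Rightarrow> 'o \<Rightarrow> 'o \<Rightarrow> bool" where
  "line_through Ob lt rk k p q l \<longleftrightarrow> l \<in> Ob \<and> rk l = Suc k \<and> lt p l \<and> lt q l"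

definition points :: "'o set \<Rightarrow> ('o \<Rightarrow> nat) \<Rightarrow> nat \<Rightarrow> 'o set" where
  "points Ob rk k = {p \<in> Ob. rk p = k}"

definition collinear ::
  "'o set \<Rightarrow> ('o \<Rightarrow> 'o \<Rightarrow> bool) \<Rightarrow> ('o \<Rightarrow> nat) \<Rightarrow> nat \<Rightarrow> 'o \<Rightarrow> 'o \<Rightarrow> bool" where
  "collinear Ob lt rk k p q \<longleftrightarrow> p \<in> points Ob rk k \<and> q \<in> points Ob rk k \<and> p \<noteq> q
     \<and> (\<exists>l. line_through Ob lt rk k p q l)"

text \<open>The triangle lies in the object \<open>W\<close>. A side may be equal to \<open>W\<close>, so three points on
  a common line are included.\<close>

definition filled ::
  "'o set \<Rightarrow> ('o \<Rightarrow> 'o \<Rightarrow> bool) \<Rightarrow> ('o \<Rightarrow> nat) \<Rightarrow> nat \<Rightarrow> 'o \<Rightarrow> 'o \<Rightarrow> 'o \<Rightarrow> bool" where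
  "filled Ob lt rk k p q r \<longleftrightarrow> (\<exists>W\<in>Ob. \<forall>(a, b) \<in> {(p, q), (q, r), (p, r)}.
     \<exists>l. line_through Ob lt rk k a b l \<and> (l = W \<or> lt l W))"

definition common_neighbours ::
  "'o set \<Rightarrow> ('o \<Rightarrow> 'o \<Rightarrow> bool) \<Rightarrow> ('o \<Rightarrow> nat) \<Rightarrow> nat \<Rightarrow> bool" where
  "common_neighbours Ob lt rk k \<longleftrightarrow>
     (\<forall>p\<in>points Ob rk k. \<forall>q\<in>points Ob rk k. \<forall>r\<in>points Ob rk k.
        \<exists>s. collinear Ob lt rk k s p \<and> collinear Ob lt rk k s q \<and> collinear Ob lt rk k s r)"

definition squares_coned ::
  "'o set \<Rightarrow> ('o \<Rightarrow> 'o \<Rightarrow> bool) \<Rightarrow> ('o \<Rightarrow> nat) \<Rightarrow> nat \<Rightarrow> bool" where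
  "squares_coned Ob lt rk k \<longleftrightarrow> (\<forall>a x y z.
     collinear Ob lt rk k a y \<longrightarrow> collinear Ob lt rk k y x \<longrightarrow> collinear Ob lt rk k a z \<longrightarrow>
     collinear Ob lt rk k z x \<longrightarrow> \<not> collinear Ob lt rk k a x \<longrightarrow> \<not> collinear Ob lt rk k y z \<longrightarrow>
     (\<exists>s. collinear Ob lt rk k s a \<and> collinear Ob lt rk k s x
        \<and> collinear Ob lt rk k s y \<and> collinear Ob lt rk k s z))"

definition triangles_filled ::
  "'o set \<Rightarrow> ('o \<Rightarrow> 'o \<Rightarrow> bool) \<Rightarrow> ('o \<Rightarrow> nat) \<Rightarrow> nat \<Rightarrow> bool" where
  "triangles_filled Ob lt rk k \<longleftrightarrow> (\<forall>p q r.
     collinear Ob lt rk k p q \<longrightarrow> collinear Ob lt rk k q r \<longrightarrow> collinear Ob lt rk k p r \<longrightarrow>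
     filled Ob lt rk k p q r \<or>
     (\<exists>s. collinear Ob lt rk k p s \<and> collinear Ob lt rk k q s \<and> collinear Ob lt rk k r s \<and>
        filled Ob lt rk k p q s \<and> filled Ob lt rk k q r s \<and> filled Ob lt rk k p r s))"

lemma line_through_commute: "line_through Ob lt rk k p q l \<longleftrightarrow> line_through Ob lt rk k q p l"
  by (auto simp: line_through_def)

lemma collinear_commute: "collinear Ob lt rk k p q \<longleftrightarrow> collinear Ob lt rk k q p"
  using line_through_commute by (fastforce simp: collinear_def)

lemma edge_collinear [simp]:
  "edge (points Ob rk k) (collinear Ob lt rk k) p q \<longleftrightarrow> collinear Ob lt rk k p q"
  by (auto simp: edge_def collinear_def)

text \<open>Geometries in which every interval has enough points, the more the longer it is. All incidence
  questions about an interval are settled by the objects in its two lowest ranks and the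
  triangles in them.\<close>

locale point_line_geometry = ranked_geometry G lt rk
  for G :: "'o set" and lt :: "'o \<Rightarrow> 'o \<Rightarrow> bool" and rk :: "'o \<Rightarrow> nat" +
  assumes line_unique: "\<And>p q l m. p \<in> G \<Longrightarrow> q \<in> G \<Longrightarrow> l \<in> G \<Longrightarrow> m \<in> G \<Longrightarrow> p \<noteq> q \<Longrightarrow> rk p = rk q
      \<Longrightarrow> rk l = Suc (rk p) \<Longrightarrow> rk m = Suc (rk p)
      \<Longrightarrow> lt p l \<Longrightarrow> lt q l \<Longrightarrow> lt p m \<Longrightarrow> lt q m \<Longrightarrow> l = m"
    and point_exists: "x \<in> G \<Longrightarrow> y \<in> G \<Longrightarrow> lt x y \<Longrightarrow> rk x + 2 \<le> rk y
      \<Longrightarrow> points (between x y) rk (Suc (rk x)) \<noteq> {}"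
    and three_points: "x \<in> G \<Longrightarrow> y \<in> G \<Longrightarrow> lt x y \<Longrightarrow> rk x + 3 \<le> rk y
      \<Longrightarrow> common_neighbours (between x y) lt rk (Suc (rk x))"
    and squares: "x \<in> G \<Longrightarrow> y \<in> G \<Longrightarrow> lt x y \<Longrightarrow> rk x + 4 \<le> rk y
      \<Longrightarrow> squares_coned (between x y) lt rk (Suc (rk x))"
    and triangles: "x \<in> G \<Longrightarrow> y \<in> G \<Longrightarrow> lt x y \<Longrightarrow> rk x + 4 \<le> rk y
      \<Longrightarrow> triangles_filled (between x y) lt rk (Suc (rk x))"
begin

lemma between_trans:
  assumes "x \<in> G" "y \<in> G" "z \<in> between x y" "w \<in> between x z"
  shows "w \<in> between x y"
  using assms lt_trans[of w z y] by (auto simp: between_def)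

lemma edge_lt:
  assumes "p \<in> between x y" "l \<in> between x y" "lt p l"
  shows "edge (between x y) (incident lt) p l" "edge (between x y) (incident lt) l p"
  using assms lt_rank[of p p] by (auto simp: edge_def incident_def between_def)

lemma point_below:
  assumes "x \<in> G" "y \<in> G" "z \<in> between x y" "rk z \<noteq> Suc (rk x)"
  shows "\<exists>p \<in> points (between x y) rk (Suc (rk x)). lt p z"
proof -
  have z: "z \<in> G" "lt x z" using assms by (auto simp: between_def)
  then have "rk x + 2 \<le> rk z" using lt_rank[of x z] assms(1,4) by simp
  then obtain p where "p \<in> between x z" "rk p = Suc (rk x)"
    using point_exists[OF assms(1) z] by (auto simp: points_def)
  moreover from this have "p \<in> between x y" using between_trans[OF assms(1-3)] by simp
  ultimately show ?thesis by (intro bexI[of _ p]) (simp_all add: points_def between_def)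
qed

text \<open>Every object of the interval contains a point, and any two points are joined through a common
  neighbour.\<close>

lemma between_connected:
  assumes "x \<in> G" "y \<in> G" "lt x y" "rk x + 3 \<le> rk y"
  shows "inc_connected (between x y) (incident lt)"
proof -
  let ?E = "edge (between x y) (incident lt)"
  obtain b where b: "b \<in> points (between x y) rk (Suc (rk x))"
    using point_exists[of x y] assms by auto
  have line: "?E\<^sup>*\<^sup>* p q" if "collinear (between x y) lt rk (Suc (rk x)) p q" for p q
  proof -
    obtain l where "p \<in> between x y" "q \<in> between x y" "l \<in> between x y" "lt p l" "lt q l"
      using \<open>collinear _ _ _ _ p q\<close> by (auto simp: collinear_def line_through_def points_def)
    then have "?E p l" "?E l q" using edge_lt by auto
    then show ?thesis by auto
  qed
  have point: "?E\<^sup>*\<^sup>* b p" if p: "p \<in> points (between x y) rk (Suc (rk x))" for p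
  proof -
    obtain s where "collinear (between x y) lt rk (Suc (rk x)) s b"
      "collinear (between x y) lt rk (Suc (rk x)) s p"
      using three_points[OF assms] b p unfolding common_neighbours_def by blast
    then show ?thesis using line collinear_commute rtranclp_trans by metis
  qed
  have "?E\<^sup>*\<^sup>* b z" if z: "z \<in> between x y" for z
  proof (cases "rk z = Suc (rk x)")
    case True
    then show ?thesis using point z by (simp add: points_def)
  next
    case False
    then obtain p where p: "p \<in> points (between x y) rk (Suc (rk x))" "lt p z"
      using point_below[OF assms(1,2) z] by blast
    then have "?E p z" using edge_lt z by (simp add: points_def)
    then show ?thesis using point[OF p(1)] by simp
  qed
  then show ?thesis
    by (rule inc_connected_step[of _ b, rotated 2]) (use b edge_sym in \<open>auto simp: points_def\<close>)
qed

definition line :: "'o \<Rightarrow> 'o \<Rightarrow> 'o \<Rightarrow> 'o \<Rightarrow> 'o" where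
  "line x y p q = (THE l. line_through (between x y) lt rk (Suc (rk x)) p q l)"

lemma line_eqI:
  assumes "p \<in> points (between x y) rk (Suc (rk x))" "q \<in> points (between x y) rk (Suc (rk x))"
    and "p \<noteq> q" "line_through (between x y) lt rk (Suc (rk x)) p q l"
  shows "line x y p q = l"
  unfolding line_def
proof (rule the_equality)
  fix m assume "line_through (between x y) lt rk (Suc (rk x)) p q m"
  then show "m = l"
    using assms line_unique[of p q m l] by (simp add: line_through_def points_def between_def)
qed (fact assms)

lemma line_in_between:
  assumes "collinear (between x y) lt rk (Suc (rk x)) p q"
  shows "line_through (between x y) lt rk (Suc (rk x)) p q (line x y p q)"
  using assms line_eqI unfolding collinear_def by metis

end

locale interval_transport = point_line_geometry G lt rk
  for G :: "'o set" and lt :: "'o \<Rightarrow> 'o \<Rightarrow> bool" and rk :: "'o \<Rightarrow> nat" +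
  fixes x y :: 'o and M :: "'o \<Rightarrow> 'c set" and T :: "'o \<Rightarrow> 'o \<Rightarrow> 'c \<Rightarrow> 'c"
  assumes x: "x \<in> G" and y: "y \<in> G" and xy: "lt x y" "rk x + 4 \<le> rk y"
    and transport: "transport (between x y) (incident lt) M T"
begin

abbreviation "Ob \<equiv> between x y"
abbreviation "P \<equiv> points Ob rk (Suc (rk x))"
abbreviation "coll \<equiv> collinear Ob lt rk (Suc (rk x))"

sublocale T: transport Ob "incident lt" M T by (rule transport)

text \<open>The induced transport on the collinearity graph: up to the joining line and down again.\<close>

definition carry where
  "carry p q c = T (line x y p q) q (T p (line x y p q) c)"

lemma up_down:
  assumes "p \<in> Ob" "l \<in> Ob" "lt p l" "c \<in> M p"
  shows "T p l c \<in> M l" "T l p (T p l c) = c"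
  by (intro T.T_closed T.T_back edge_lt assms)+

lemma up_up:
  assumes "p \<in> Ob" "l \<in> Ob" "z \<in> Ob" "lt p l" "lt l z" "c \<in> M p"
  shows "T l z (T p l c) = T p z c"
proof -
  have "lt p z" using assms lt_trans[of p l z] by (auto simp: between_def)
  then show ?thesis
    by (intro T.T_triangle edge_lt assms)
qed

lemma up_down_down:
  assumes "p \<in> Ob" "l \<in> Ob" "z \<in> Ob" "lt p l" "lt l z" "c \<in> M z"
  shows "T l p (T z l c) = T z p c"
proof -
  have "lt p z" using assms lt_trans[of p l z] by (auto simp: between_def)
  then show ?thesis
    by (intro T.T_triangle edge_lt assms)
qed

text \<open>Any object through the line of \<open>p\<close> and \<open>q\<close> serves as well as the line, by the two triangles that it
  forms with the line and one of the points. In a filled triangle all three sides can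
  therefore be carried through one and the same object.\<close>

lemma carry_via:
  assumes pq: "coll p q" and l: "line_through Ob lt rk (Suc (rk x)) p q l"
    and W: "W \<in> Ob" "l = W \<or> lt l W" and c: "c \<in> M p"
  shows "carry p q c = T W q (T p W c)" "lt p W" "lt q W"
proof -
  have pqO: "p \<in> Ob" "q \<in> Ob" "p \<noteq> q" "line x y p q = l"
    using pq line_eqI l by (auto simp: collinear_def points_def)
  have l': "l \<in> Ob" "lt p l" "lt q l" using l by (auto simp: line_through_def)
  have "carry p q c = T W q (T p W c) \<and> lt p W \<and> lt q W"
  proof (cases "l = W")
    case True
    then show ?thesis using pqO l' by (simp add: carry_def)
  next
    case False
    then have "lt l W" using W by simp
    moreover from this have "lt p W" "lt q W"
      using lt_trans[of _ l W] pqO l' W by (auto simp: between_def)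
    moreover have "T p l c = T W l (T p W c)"
      using up_up[of p l W c] up_down[of l W "T p l c"] up_down[of p l c] pqO l' W c \<open>lt l W\<close> by simp
    moreover have "T p W c \<in> M W" using up_down \<open>lt p W\<close> pqO W c by simp
    ultimately show ?thesis using up_down_down[of q l W "T p W c"] pqO l' W by (simp add: carry_def)
  qed
  then show "carry p q c = T W q (T p W c)" "lt p W" "lt q W" by auto
qed

lemma carry_closed:
  assumes "coll p q" "c \<in> M p"
  shows "carry p q c \<in> M q" "carry q p (carry p q c) = c"
proof -
  define l where "l = line x y p q"
  have l: "line_through Ob lt rk (Suc (rk x)) p q l" unfolding l_def
    by (rule line_in_between) (fact assms)
  have O: "p \<in> Ob" "q \<in> Ob" "l \<in> Ob" "lt p l" "lt q l"
    using assms l by (auto simp: collinear_def line_through_def points_def)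
  have "line x y q p = l"
    using line_eqI[of q x y p l] assms l line_through_commute[of Ob lt rk "Suc (rk x)" p q l]
    by (auto simp: collinear_def)
  moreover have "T p l c \<in> M l" using up_down O assms by simp
  ultimately show "carry p q c \<in> M q" "carry q p (carry p q c) = c"
    using up_down[of p l c] O assms(2) T.T_closed[of l q "T p l c"] T.T_back[of l q "T p l c"]
      edge_lt[of q x y l] by (simp_all add: carry_def flip: l_def)
qed

lemma carry_filled:
  assumes f: "filled Ob lt rk (Suc (rk x)) p q r" and e: "coll p q" "coll q r" "coll p r"
    and c: "c \<in> M p"
  shows "carry q r (carry p q c) = carry p r c"
proof -
  obtain W l m n where W: "W \<in> Ob"
    and l: "line_through Ob lt rk (Suc (rk x)) p q l" "l = W \<or> lt l W"
    and m: "line_through Ob lt rk (Suc (rk x)) q r m" "m = W \<or> lt m W"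
    and n: "line_through Ob lt rk (Suc (rk x)) p r n" "n = W \<or> lt n W"
    using f unfolding filled_def by auto
  have O: "p \<in> Ob" "q \<in> Ob" using e by (auto simp: collinear_def points_def)
  note pq = carry_via[OF e(1) l(1) W l(2) c]
  have TM: "T p W c \<in> M W" using up_down[OF O(1) W pq(2) c] by simp
  have "carry p q c \<in> M q" using carry_closed e(1) c by simp
  then have "carry q r (carry p q c) = T W r (T q W (T W q (T p W c)))"
    using carry_via(1)[OF e(2) m(1) W m(2)] pq(1) by simp
  also have "\<dots> = T W r (T p W c)"
    using T.T_back[of W q "T p W c"] TM edge_lt[OF O(2) W pq(3)] by simp
  also have "\<dots> = carry p r c" using carry_via(1)[OF e(3) n(1) W n(2) c] by simp
  finally show ?thesis .
qed

text \<open>If \<open>s\<close> is the apex over an unfilled triangle, both ways from \<open>p\<close> to \<open>r\<close>, continued to \<open>s\<close>, agree with the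
  direct step from \<open>p\<close> to \<open>s\<close>.\<close>

lemma carry_triangle:
  assumes e: "coll p q" "coll q r" "coll p r" and c: "c \<in> M p"
  shows "carry q r (carry p q c) = carry p r c"
proof -
  consider "filled Ob lt rk (Suc (rk x)) p q r"
    | s where "coll p s" "coll q s" "coll r s" "filled Ob lt rk (Suc (rk x)) p q s"
      "filled Ob lt rk (Suc (rk x)) q r s" "filled Ob lt rk (Suc (rk x)) p r s"
    using triangles[OF x y xy] e unfolding triangles_filled_def by blast
  then show ?thesis
  proof cases
    case 1
    then show ?thesis using carry_filled e c by blast
  next
    case (2 s)
    have M: "carry p q c \<in> M q" "carry q r (carry p q c) \<in> M r" "carry p r c \<in> M r"
      using carry_closed e c by auto
    have "carry r s (carry q r (carry p q c)) = carry p s c"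
      using carry_filled[OF 2(5) e(2) 2(3,2) M(1)] carry_filled[OF 2(4) e(1) 2(2,1) c] by simp
    also have "\<dots> = carry r s (carry p r c)"
      using carry_filled[OF 2(6) e(3) 2(3,1) c] by simp
    finally show ?thesis using carry_closed(2)[OF 2(3)] M(2,3) by metis
  qed
qed

lemma transport_points: "transport P coll M carry"
proof
  show "edge P coll p q \<Longrightarrow> edge P coll q p" for p q
    using collinear_commute[of Ob lt rk "Suc (rk x)" p q] by simp
qed (use carry_closed carry_triangle in simp_all)

text \<open>Two points of \<open>z\<close> are joined inside \<open>z\<close> by a path of at most two lines, because the interval below \<open>z\<close>
  satisfies the assumption on common neighbours too, or \<open>z\<close> is itself their line.\<close>

lemma same_value_above:
  assumes h: "flat_section P coll M carry h"
    and pq: "p \<in> P" "q \<in> P" and z: "z \<in> Ob" "lt p z" "lt q z"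
  shows "T p z (h p) = T q z (h q)"
proof -
  have hM: "h s \<in> M s" if "s \<in> P" for s using h that by (simp add: flat_section_def)
  have on_line: "T s z (h s) = T t z (h t)"
    if s: "s \<in> P" "t \<in> P" "s \<noteq> t" "line_through Ob lt rk (Suc (rk x)) s t l" "l = z \<or> lt l z" for s t l
  proof -
    have st: "coll s t" using s by (auto simp: collinear_def)
    then have "h t = carry s t (h s)" using h by (simp add: flat_section_def)
    then have "h t = T z t (T s z (h s))" "lt s z" "lt t z"
      using carry_via[OF st s(4) z(1) s(5) hM[OF s(1)]] by auto
    moreover have "T s z (h s) \<in> M z" using up_down(1) z(1) hM s \<open>lt s z\<close> by (simp add: points_def)
    ultimately show ?thesis
      using T.T_back[of z t "T s z (h s)"] edge_lt[of t x y z] z s by (simp add: points_def)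
  qed
  have zG: "z \<in> G" "lt x z" and pG: "p \<in> between x z" "q \<in> between x z"
    and rk: "rk p = Suc (rk x)" "rk q = Suc (rk x)"
    using z pq by (auto simp: between_def points_def)
  show ?thesis
  proof (cases "p = q \<or> rk z = Suc (Suc (rk x))")
    case True
    then show ?thesis using on_line[of p q z] pq z by (auto simp: line_through_def)
  next
    case False
    moreover have "Suc (rk x) < rk z" using lt_rank[of p z] pG rk zG z by (auto simp: between_def)
    ultimately have "rk x + 3 \<le> rk z" by simp
    then obtain s where s: "collinear (between x z) lt rk (Suc (rk x)) s p"
      "collinear (between x z) lt rk (Suc (rk x)) s q"
      using three_points[OF x zG] pG rk unfolding common_neighbours_def points_def by blast
    have step: "T s z (h s) = T t z (h t)"
      if st: "collinear (between x z) lt rk (Suc (rk x)) s t" for t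
    proof -
      obtain l where l: "line_through (between x z) lt rk (Suc (rk x)) s t l"
        using st by (auto simp: collinear_def)
      then have "line_through Ob lt rk (Suc (rk x)) s t l" "lt l z"
        using between_trans[OF x y z(1)] by (auto simp: line_through_def between_def)
      moreover have "s \<in> P" "t \<in> P" "s \<noteq> t"
        using st between_trans[OF x y z(1)] by (auto simp: collinear_def points_def)
      ultimately show ?thesis using on_line by blast
    qed
    show ?thesis using step[OF s(1)] step[OF s(2)] by simp
  qed
qed

text \<open>An object takes the value transported up from any of its points, which does not depend on the point
  by \<open>same_value_above\<close>.\<close>

lemma extend_flat_section:
  assumes h: "flat_section P coll M carry h"
  shows "\<exists>H. flat_section Ob (incident lt) M T H \<and> (\<forall>p\<in>P. H p = h p)"
proof -
  have hM: "h s \<in> M s" if "s \<in> P" for s using h that by (simp add: flat_section_def)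
  define pt where "pt z = (SOME p. p \<in> P \<and> lt p z)" for z
  define H where "H z = (if z \<in> P then h z else T (pt z) z (h (pt z)))" for z
  have pt: "pt z \<in> P" "lt (pt z) z" if "z \<in> Ob" "z \<notin> P" for z
  proof -
    have "\<exists>p. p \<in> P \<and> lt p z"
      using point_below[OF x y that(1)] that by (auto simp: points_def)
    then have "pt z \<in> P \<and> lt (pt z) z" unfolding pt_def by (rule someI_ex)
    then show "pt z \<in> P" "lt (pt z) z" by auto
  qed
  have H: "H z = T p z (h p)" if "p \<in> P" "z \<in> Ob" "lt p z" for p z
  proof -
    have "rk p < rk z" using that lt_rank[of p z] by (auto simp: points_def between_def)
    then have "z \<notin> P" using that by (auto simp: points_def)
    then show ?thesis using same_value_above[OF h _ that(1) that(2) _ that(3)] pt that(2) by (simp add: H_def)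
  qed
  have HM: "H z \<in> M z" if "z \<in> Ob" for z
    using that pt[OF that] hM up_down(1)[of "pt z" z] by (auto simp: H_def points_def)
  have up: "H w = T z w (H z)" if "z \<in> Ob" "w \<in> Ob" "lt z w" for z w
  proof (cases "z \<in> P")
    case True
    then show ?thesis using H[OF True] that by (simp add: H_def)
  next
    case False
    note p = pt[OF that(1) False]
    have "lt (pt z) w" using lt_trans[of "pt z" z w] p that by (auto simp: points_def between_def)
    then show ?thesis
      using H[OF p(1)] that p up_up[of "pt z" z w "h (pt z)"] hM[OF p(1)] by (simp add: points_def)
  qed
  have "H w = T z w (H z)" if "edge Ob (incident lt) z w" for z w
  proof -
    have zw: "z \<in> Ob" "w \<in> Ob" and "lt z w \<or> lt w z" using that by (auto simp: edge_def incident_def)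
    then show ?thesis using up[of z w] up[of w z] up_down(2)[of w z "H w"] HM by auto
  qed
  then have "flat_section Ob (incident lt) M T H" unfolding flat_section_def using HM by simp
  moreover have "\<forall>p\<in>P. H p = h p" by (simp add: H_def)
  ultimately show ?thesis by (intro exI[of _ H] conjI)
qed

lemma flat_section_at_point:
  assumes "b \<in> P" "c \<in> M b"
  shows "\<exists>H. flat_section Ob (incident lt) M T H \<and> H b = c"
proof -
  have "rk x + 3 \<le> rk y" using xy by simp
  then have three: "\<exists>s. coll s p \<and> coll s q \<and> coll s r" if "p \<in> P" "q \<in> P" "r \<in> P" for p q r
    using three_points[OF x y xy(1)] that unfolding common_neighbours_def by blast
  have "\<exists>h. flat_section P coll M carry h \<and> h b = c"
  proof (rule flat_section_if_common_neighbours[OF transport_points])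
    show "\<exists>s. edge P coll s a \<and> edge P coll s u \<and> edge P coll s v \<and> edge P coll s w"
      if "edge P coll a v" "edge P coll v u" "edge P coll a w" "edge P coll w u"
        "\<not> edge P coll a u" "\<not> edge P coll v w" for a u v w
      using squares[OF x y xy] that unfolding squares_coned_def edge_collinear by blast
  qed (use three assms in simp_all)
  then obtain h where h: "flat_section P coll M carry h" "h b = c" by auto
  obtain H where "flat_section Ob (incident lt) M T H" "\<forall>p\<in>P. H p = h p"
    using extend_flat_section[OF h(1)] by auto
  then show ?thesis using h(2) assms(1) by (intro exI[of _ H]) simp
qed

end

context point_line_geometry
begin

theorem connectivity_level_between:
  assumes "x \<in> G" "y \<in> G" "lt x y"
  shows "connectivity_level (rk y - rk x - 1) (between x y) (incident lt)"
proof -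
  have "\<exists>b. trivial_transports (between x y) (incident lt) b" if "rk x + 4 \<le> rk y"
  proof -
    have "rk x + 2 \<le> rk y" using that by simp
    then obtain b where b: "b \<in> points (between x y) rk (Suc (rk x))"
      using point_exists[OF assms] by blast
    have "trivial_transports (between x y) (incident lt) b"
      unfolding trivial_transports_def
    proof (intro conjI allI impI ballI)
      show "b \<in> between x y" using b by (simp add: points_def)
      fix M and T :: "'o \<Rightarrow> 'o \<Rightarrow> 'o list set \<Rightarrow> 'o list set" and c
      assume t: "transport (between x y) (incident lt) M T" and c: "c \<in> M b"
      interpret interval_transport G lt rk x y M T
        by (intro interval_transport.intro interval_transport_axioms.intro
            point_line_geometry_axioms assms that t)
      show "\<exists>h. flat_section (between x y) (incident lt) M T h \<and> h b = c"
        using flat_section_at_point b c by blast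
    qed
    then show ?thesis by blast
  qed
  moreover have "between x y \<noteq> {}" if "rk x + 2 \<le> rk y"
    using point_exists[OF assms that] by (auto simp: points_def)
  ultimately show ?thesis using between_connected[OF assms] by (auto simp: connectivity_level_def)
qed

theorem flag_residue_simply_connected:
  assumes "x \<in> G" "y \<in> G" "lt x y" "finite F" "flag (between x y) (incident lt) F"
    and "rk x + card F + 4 \<le> rk y"
  shows "inc_simply_connected (flag_residue (between x y) (incident lt) F) (incident lt)"
proof -
  have "3 \<le> rk y - rk x - 1 - card F" using assms(6) by simp
  then have "inc_connected (flag_residue (between x y) (incident lt) F) (incident lt)"
    and "\<exists>b. trivial_transports (flag_residue (between x y) (incident lt) F) (incident lt) b"
    using connectivity_level_flag_residue[OF connectivity_level_between assms(1-5)] unfolding connectivity_level_def by simp_all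
  then show ?thesis using simply_connected_if_transports_trivial[OF edge_sym] by blast
qed

end

section \<open>Orthogonality in symplectic spaces\<close>

context symplectic_space
begin

lemma form_add_left: "form (x + y) z = form x z + form y z"
  using form_linear_left[of z] unfolding Vector_Spaces.linear_iff by blast

lemma form_add_right: "form x (y + z) = form x y + form x z"
  using form_linear_right[of x] unfolding Vector_Spaces.linear_iff by blast

lemma form_scale_left: "form (scale c x) z = c * form x z"
  using form_linear_left[of z] unfolding Vector_Spaces.linear_iff by blast

lemma form_scale_right: "form x (scale c z) = c * form x z"
  using form_linear_right[of x] unfolding Vector_Spaces.linear_iff by blast

lemma form_zero [simp]: "form 0 x = 0" "form x 0 = 0"
  using form_scale_left[of 0 0 x] form_scale_right[of x 0 0] by simp_all

lemma form_diff_left: "form (x - y) z = form x z - form y z"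
  using form_add_left[of "x - y" y z] by simp

lemma form_diff_right: "form x (y - z) = form x y - form x z"
  using form_add_right[of x "y - z" z] by simp

lemma form_antisym: "form y x = - form x y"
proof -
  have "form (x + y) (x + y) = form x y + form y x"
    unfolding form_add_left form_add_right by (simp add: form_alternating)
  then have "form x y + form y x = 0" unfolding form_alternating by (rule sym)
  then show ?thesis by (metis add.commute eq_neg_iff_add_eq_0)
qed

lemma form_eq_0_sym: "form y x = 0 \<longleftrightarrow> form x y = 0"
  by (simp add: form_antisym[of y x])

lemmas form_simps = form_add_left form_add_right form_diff_left form_diff_right
  form_scale_left form_scale_right form_alternating

lemma subspace_perp [simp]: "subspace (perp U)"
  by (auto simp: subspace_def perp_def form_simps)

lemma perp_span [simp]: "perp (span S) = perp S"
proof
  show "perp (span S) \<subseteq> perp S" using span_superset by (auto simp: perp_def)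
  show "perp S \<subseteq> perp (span S)"
  proof
    fix v assume v: "v \<in> perp S"
    have "subspace {u. form u v = 0}" by (auto simp: subspace_def form_simps)
    then have "span S \<subseteq> {u. form u v = 0}" using v by (intro span_minimal) (auto simp: perp_def)
    then show "v \<in> perp (span S)" by (auto simp: perp_def)
  qed
qed

lemma perp_antimono: "S \<subseteq> U \<Longrightarrow> perp U \<subseteq> perp S"
  by (auto simp: perp_def)

lemma subspace_Rad [simp]: "subspace U \<Longrightarrow> subspace (Rad U)"
  by (simp add: Rad_def subspace_inter)

lemma dim_less: "subspace X \<Longrightarrow> subspace Y \<Longrightarrow> X \<subset> Y \<Longrightarrow> dim X < dim Y"
  using dim_psubset[of X Y] by (simp add: span_eq_iff[THEN iffD2])

lemma dim_hyperplane: "subspace U \<Longrightarrow> dim U \<le> Suc (dim (U \<inter> perp {b}))"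
proof (cases "U \<subseteq> perp {b}")
  case True
  then show ?thesis by (simp add: Int_absorb2)
next
  case False
  assume U: "subspace U"
  obtain v where v: "v \<in> U" "form b v \<noteq> 0" using False by (auto simp: perp_def)
  have "U \<subseteq> span (insert v (U \<inter> perp {b}))"
  proof
    fix u assume u: "u \<in> U"
    have "u - scale (form b u / form b v) v \<in> U \<inter> perp {b}"
      using u v U by (auto simp: perp_def form_simps subspace_diff subspace_scale)
    then show "u \<in> span (insert v (U \<inter> perp {b}))"
      unfolding span_breakdown_eq using span_superset by blast
  qed
  then have "dim U \<le> dim (insert v (U \<inter> perp {b}))" using dim_mono by blast
  then show ?thesis by (simp add: dim_insert split: if_splits)
qed

lemma dim_perp_finite:
  assumes "subspace U" "finite B"
  shows "dim U \<le> card B + dim (U \<inter> perp B)"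
  using assms(2)
proof (induction B rule: finite_induct)
  case empty
  then show ?case by (simp add: perp_def)
next
  case (insert b B)
  have "U \<inter> perp (insert b B) = (U \<inter> perp B) \<inter> perp {b}" by (auto simp: perp_def)
  moreover have "subspace (U \<inter> perp B)" using assms by (simp add: subspace_inter)
  ultimately have "dim (U \<inter> perp B) \<le> Suc (dim (U \<inter> perp (insert b B)))"
    using dim_hyperplane[of "U \<inter> perp B" b] by simp
  then show ?case using insert by simp
qed

text \<open>Imposing one linear condition lowers the dimension by at most one.\<close>

lemma dim_perp:
  assumes "subspace U"
  shows "dim U \<le> dim X + dim (U \<inter> perp X)"
proof -
  obtain B where B: "B \<subseteq> X" "independent B" "X \<subseteq> span B" "card B = dim X"
    using basis_exists by blast
  have "span B = span X" using B span_eq by (meson span_superset subset_trans)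
  then have "perp B = perp X" by (metis perp_span)
  then show ?thesis using dim_perp_finite[OF assms, of B] finiteI_independent[OF B(2)] B(4) by simp
qed

text \<open>\<open>X\<close> and its orthogonal intersect trivially, and their dimensions add up to at least that of the
  whole space.\<close>

lemma nondegenerate_decomposition:
  assumes X: "subspace X" "X \<inter> perp X = {0}"
  shows "\<exists>x\<in>X. v - x \<in> perp X"
proof -
  let ?S = "{x + y |x y. x \<in> X \<and> y \<in> perp X}"
  have "dim ?S + dim (X \<inter> perp X) = dim X + dim (perp X)"
    by (rule dim_sums_Int) (simp_all add: X)
  moreover have "dim (UNIV :: 'v set) \<le> dim X + dim (perp X)"
    using dim_perp[OF subspace_UNIV, of X] by simp
  ultimately have "dim (UNIV :: 'v set) \<le> dim ?S" by (simp add: X(2))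
  moreover have "subspace ?S" by (rule subspace_sums) (simp_all add: X)
  ultimately have "?S = UNIV" using subspace_dim_equal[of ?S UNIV] by simp
  then have "v \<in> ?S" by simp
  then obtain x y where "v = x + y" "x \<in> X" "y \<in> perp X" by blast
  then show ?thesis by (intro bexI[of _ x]) simp_all
qed

definition good :: "'v set \<Rightarrow> bool" where
  "good U \<longleftrightarrow> subspace U \<and> dim (Rad U) \<le> 1"

text \<open>For \<open>X \<subseteq> Y\<close> the second condition is equivalent to \<open>X \<inter> Rad Y = {0}\<close>. With the orthogonal in place of
  the radical it persists when \<open>X\<close> shrinks and when \<open>Y\<close> grows, which gives transitivity.\<close>

definition below :: "'v set \<Rightarrow> 'v set \<Rightarrow> bool" where
  "below X Y \<longleftrightarrow> X \<subset> Y \<and> X \<inter> perp Y = {0}"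

lemma below_trans: "below X Y \<Longrightarrow> below Y Z \<Longrightarrow> below X Z"
  unfolding below_def by blast

text \<open>\<open>X\<close> and \<open>Rad Y\<close> are independent inside \<open>Y\<close>, so \<open>Rad Y\<close> has dimension at most \<open>dim Y - dim X\<close>.\<close>

lemma good_if_below:
  assumes "subspace X" "subspace Y" "below X Y" "dim Y \<le> Suc (dim X)"
  shows "good Y"
proof -
  have "X \<inter> Rad Y = {0}"
    using assms by (auto simp: below_def Rad_def subspace_0)
  then have "dim {x + y |x y. x \<in> X \<and> y \<in> Rad Y} = dim X + dim (Rad Y)"
    using dim_sums_Int[of X "Rad Y"] assms by simp
  moreover have "{x + y |x y. x \<in> X \<and> y \<in> Rad Y} \<subseteq> Y"
    using assms by (auto simp: below_def Rad_def intro!: subspace_add)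
  then have "dim {x + y |x y. x \<in> X \<and> y \<in> Rad Y} \<le> dim Y" by (rule dim_subset)
  ultimately have "dim X + dim (Rad Y) \<le> dim Y" by simp
  then show ?thesis using assms by (simp add: good_def)
qed

lemma two_nonvanishing:
  assumes U: "subspace U" and a: "x1 \<in> U" "form a x1 \<noteq> 0" and b: "x2 \<in> U" "form b x2 \<noteq> 0"
  shows "\<exists>x\<in>U. form a x \<noteq> 0 \<and> form b x \<noteq> 0"
proof (cases "form b x1 = 0 \<and> form a x2 = 0")
  case True
  then show ?thesis using assms subspace_add[OF U a(1) b(1)]
    by (intro bexI[of _ "x1 + x2"]) (auto simp: form_simps)
next
  case False
  then show ?thesis using assms by blast
qed

text \<open>Combine \<open>v\<close>, not orthogonal to \<open>a\<close> and \<open>b\<close>, with \<open>w\<close>, not orthogonal to \<open>a\<close> and \<open>c\<close>. Unless one of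
  them serves for all three, \<open>v + t w\<close> serves for \<open>b\<close> and \<open>c\<close> whenever \<open>t \<noteq> 0\<close>, and only one further
  value of \<open>t\<close> is excluded by \<open>a\<close>. The field needs a third element: over the field of two
  elements the three hyperplanes through a subspace of codimension two cover the space.\<close>

lemma three_nonvanishing:
  assumes F: "\<And>a b :: 'f. \<exists>t. t \<noteq> a \<and> t \<noteq> b"
    and U: "subspace U" and a: "\<exists>x\<in>U. form a x \<noteq> 0" and b: "\<exists>x\<in>U. form b x \<noteq> 0"
    and c: "\<exists>x\<in>U. form c x \<noteq> 0"
  shows "\<exists>x\<in>U. form a x \<noteq> 0 \<and> form b x \<noteq> 0 \<and> form c x \<noteq> 0"
proof -
  obtain v where v: "v \<in> U" "form a v \<noteq> 0" "form b v \<noteq> 0"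
    using two_nonvanishing[OF U] a b by blast
  obtain w where w: "w \<in> U" "form a w \<noteq> 0" "form c w \<noteq> 0"
    using two_nonvanishing[OF U] a c by blast
  show ?thesis
  proof (cases "form c v = 0 \<and> form b w = 0")
    case False
    then show ?thesis using v w by blast
  next
    case True
    obtain t where t: "t \<noteq> 0" "t \<noteq> - form a v / form a w" using F by blast
    have "v + scale t w \<in> U" using v w U by (simp add: subspace_add subspace_scale)
    moreover have "form a (v + scale t w) \<noteq> 0"
    proof
      assume "form a (v + scale t w) = 0"
      then have "t * form a w = - form a v" by (simp add: form_simps eq_neg_iff_add_eq_0 add.commute)
      then have "t = - form a v / form a w" using nonzero_eq_divide_eq[OF w(2)] by blast
      then show False using t(2) by simp
    qed
    moreover have "form b (v + scale t w) \<noteq> 0" "form c (v + scale t w) \<noteq> 0"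
      using True v w t by (simp_all add: form_simps)
    ultimately show ?thesis by blast
  qed
qed

end

context symplectic_space
begin

sublocale subspaces: ranked_geometry "Collect good" below dim
proof
  show "below x y \<Longrightarrow> below y z \<Longrightarrow> below x z" for x y z by (rule below_trans)
  show "x \<in> Collect good \<Longrightarrow> y \<in> Collect good \<Longrightarrow> below x y \<Longrightarrow> dim x < dim y" for x y
    using dim_less by (simp add: good_def below_def)
qed

abbreviation between :: "'v set \<Rightarrow> 'v set \<Rightarrow> 'v set set" where "between \<equiv> subspaces.between"

lemma between_iff: "Z \<in> between X Y \<longleftrightarrow> good Z \<and> below X Z \<and> below Z Y"
  by (simp add: subspaces.between_def)

lemma in_span_insert_iff: "z \<in> span (insert v S) \<longleftrightarrow> (\<exists>a y. y \<in> span S \<and> z = scale a v + y)"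
proof -
  have "z - scale a v \<in> span S \<longleftrightarrow> (\<exists>y. y \<in> span S \<and> z = scale a v + y)" for a
    by (metis add_diff_cancel_left' diff_add_cancel add.commute)
  then show ?thesis unfolding span_breakdown_eq by blast
qed

lemma in_span_singleton_iff: "z \<in> span {v} \<longleftrightarrow> (\<exists>a. z = scale a v)"
  using in_span_insert_iff[of z v "{}"] by simp

lemma in_span_pair_iff: "z \<in> span {v, w} \<longleftrightarrow> (\<exists>a b. z = scale a v + scale b w)"
  unfolding in_span_insert_iff[of z v "{w}"] in_span_singleton_iff by blast

lemma in_span_triple_iff: "z \<in> span {v, w, u} \<longleftrightarrow> (\<exists>a b c. z = scale a v + (scale b w + scale c u))"
  unfolding in_span_insert_iff[of z v "{w, u}"] in_span_pair_iff by blast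

text \<open>Both \<open>X \<inter> X\<^sup>\<bottom>\<close> and \<open>Z \<inter> Z\<^sup>\<bottom>\<close> contain \<open>X \<inter> Z\<^sup>\<bottom>\<close>.\<close>

lemma below_nondegenerate:
  assumes "subspace X" "subspace Z" "X \<subset> Z" "X \<inter> perp X = {0} \<or> Z \<inter> perp Z = {0}"
  shows "below X Z"
proof -
  have "perp Z \<subseteq> perp X" using assms perp_antimono by blast
  moreover have "0 \<in> X" "0 \<in> perp Z" using assms by (simp_all add: subspace_0)
  ultimately show ?thesis unfolding below_def using assms by blast
qed

lemma good_nondegenerate: "subspace Z \<Longrightarrow> Z \<inter> perp Z = {0} \<Longrightarrow> good Z"
  by (simp add: good_def Rad_def)

lemma below_zero: "subspace Z \<Longrightarrow> Z \<noteq> {0} \<Longrightarrow> below {0} Z"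
  unfolding below_def using subspace_0[of Z] subspace_0[OF subspace_perp, of Z] by blast

lemma hyperbolic_pair:
  assumes "form v w \<noteq> 0"
  shows "span {v, w} \<inter> perp (span {v, w}) = {0}" "dim (span {v, w}) = 2" "w \<notin> span {v}" "v \<noteq> 0"
proof -
  show v: "v \<noteq> 0" using assms by auto
  show w: "w \<notin> span {v}" using assms by (auto simp: in_span_singleton_iff form_simps)
  have "dim (insert w {v}) = 2" using v w by (simp add: dim_insert)
  then show "dim (span {v, w}) = 2" by (simp add: insert_commute)
  have "z = 0" if z: "z \<in> span {v, w}" "z \<in> perp {v, w}" for z
  proof -
    obtain a b where ab: "z = scale a v + scale b w" using z(1) by (auto simp: in_span_pair_iff)
    have "form v z = 0" "form w z = 0" using z(2) by (auto simp: perp_def)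
    then have "b = 0" "a = 0" using ab assms form_eq_0_sym[of v w] by (simp_all add: form_simps)
    then show ?thesis using ab by simp
  qed
  then show "span {v, w} \<inter> perp (span {v, w}) = {0}"
    using subspace_0[of "span {v, w}"] subspace_0[OF subspace_perp, of "{v, w}"] by auto
qed

lemma span_subset: "subspace U \<Longrightarrow> S \<subseteq> U \<Longrightarrow> span S \<subseteq> U"
  by (rule span_minimal)

end

section \<open>Intervals above the zero space\<close>

context symplectic_space
begin

lemma dim_span_triple_le: "dim (span {v, w, u}) \<le> 3"
  by (simp add: dim_insert)

lemma dim_span_quadruple_le: "dim (span {v, w, u, x}) \<le> 4"
  by (simp add: dim_insert)

lemma not_perp_if_form: "u \<in> U \<Longrightarrow> form v u \<noteq> 0 \<Longrightarrow> v \<notin> perp U"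
  using form_eq_0_sym by (auto simp: perp_def)

lemma form_if_not_perp: "v \<notin> perp U \<Longrightarrow> \<exists>u\<in>U. form v u \<noteq> 0"
  using form_eq_0_sym by (auto simp: perp_def)

end

text \<open>The interval between \<open>0\<close> and \<open>U\<close>. The assumption on the field says that it has at least three elements.\<close>

locale good_subspace = symplectic_space scale Basis form
  for scale :: "'f::field \<Rightarrow> 'v::ab_group_add \<Rightarrow> 'v" and Basis :: "'v set" and form +
  fixes U :: "'v set"
  assumes good_U: "good U"
    and large_field: "\<exists>t. t \<noteq> (a :: 'f) \<and> t \<noteq> b"
begin

lemma U: "subspace U" "dim (Rad U) \<le> 1"
  using good_U by (auto simp: good_def)

abbreviation "E0 \<equiv> between {0} U"
abbreviation "coll0 \<equiv> collinear E0 below dim (Suc 0)"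
abbreviation "filled0 \<equiv> filled E0 below dim (Suc 0)"

lemma line_span_in:
  assumes "v \<in> U" "w \<in> U" "form v w \<noteq> 0" "3 \<le> dim U"
  shows "span {v, w} \<in> E0" "below (span {v, w}) U"
proof -
  note hp = hyperbolic_pair[OF assms(3)]
  have "span {v, w} \<subseteq> U" using assms U by (simp add: span_subset)
  moreover have "span {v, w} \<noteq> U" using hp(2) assms(4) by auto
  ultimately show b: "below (span {v, w}) U" using below_nondegenerate[of "span {v, w}" U] U hp(1) by auto
  have "v \<in> span {v, w}" by (simp add: span_base)
  then have "below {0} (span {v, w})" using below_zero hp(4) by auto
  then show "span {v, w} \<in> E0" using good_nondegenerate hp(1) b by (simp add: between_iff)
qed

lemma below_line:
  assumes "form v w \<noteq> 0"
  shows "below (span {v}) (span {v, w})" "below (span {w}) (span {v, w})"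
proof -
  note hp = hyperbolic_pair[OF assms]
  have "span {v} \<subseteq> span {v, w}" "span {w} \<subseteq> span {v, w}" by (rule span_mono, blast)+
  moreover have "v \<notin> span {w}" using hyperbolic_pair(3)[of w v] assms form_eq_0_sym by blast
  then have "span {v} \<noteq> span {v, w}" "span {w} \<noteq> span {v, w}"
    using hp(3) span_base[of v "{v, w}"] span_base[of w "{v, w}"] by auto
  ultimately show "below (span {v}) (span {v, w})" "below (span {w}) (span {v, w})"
    using below_nondegenerate hp(1) by (metis psubsetI subspace_span)+
qed

lemma point_span:
  assumes "v \<in> U" "v \<notin> perp U" "2 \<le> dim U"
  shows "span {v} \<in> points E0 dim (Suc 0)"
proof -
  have "v \<noteq> 0" using assms(2) subspace_0[OF subspace_perp] by auto
  then have dim: "dim (span {v}) = 1" by simp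
  then have "span {v} \<noteq> U" using assms by auto
  moreover have "span {v} \<subseteq> U" using assms U by (simp add: span_subset)
  moreover have "span {v} \<inter> perp U \<subseteq> {0}"
  proof
    fix z assume z: "z \<in> span {v} \<inter> perp U"
    then obtain a where a: "z = scale a v" by (auto simp: in_span_singleton_iff)
    have "a = 0"
    proof (rule ccontr)
      assume "a \<noteq> 0"
      then have "v = scale (inverse a) z" using a by simp
      then show False using z assms(2) subspace_scale[OF subspace_perp] by blast
    qed
    then show "z \<in> {0}" using a by simp
  qed
  ultimately have "below (span {v}) U"
    unfolding below_def using subspace_0[OF subspace_span, of "{v}"] subspace_0[OF subspace_perp, of U] by blast
  moreover have "below {0} (span {v})"
    using below_zero[of "span {v}"] \<open>v \<noteq> 0\<close> span_base[of v "{v}"] by auto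
  moreover have "good (span {v})"
    using dim dim_subset[of "Rad (span {v})" "span {v}"] by (simp add: good_def Rad_def)
  ultimately show ?thesis using dim by (simp add: points_def between_iff)
qed

lemma pointE:
  assumes "Z \<in> points E0 dim (Suc 0)"
  obtains v where "v \<in> U" "v \<notin> perp U" "Z = span {v}"
proof -
  have Z: "subspace Z" "below Z U" "dim Z = 1"
    using assms by (auto simp: points_def between_iff good_def)
  have "\<not> Z \<subseteq> {0}" using Z(3) dim_subset[of Z "{0}"] by auto
  then obtain v where v: "v \<in> Z" "v \<noteq> 0" by blast
  have "span {v} = Z"
    using subspace_dim_equal[of "span {v}" Z] Z v by (simp add: span_subset)
  moreover have "v \<in> U" "v \<notin> perp U" using Z(2) v by (auto simp: below_def)
  ultimately show ?thesis using that by blast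
qed

text \<open>If \<open>v\<close> and \<open>w\<close> are orthogonal, then \<open>v\<close> lies in the radical of any two-dimensional space through
  both, which therefore does not lie above the point \<open>\<langle>v\<rangle>\<close>. Otherwise \<open>\<langle>v, w\<rangle>\<close> is nondegenerate.\<close>

lemma collinear_span_iff:
  assumes v: "v \<in> U" "v \<notin> perp U" and w: "w \<in> U" "w \<notin> perp U" and dim: "3 \<le> dim U"
  shows "coll0 (span {v}) (span {w}) \<longleftrightarrow> form v w \<noteq> 0"
proof
  assume "form v w \<noteq> 0"
  note hp = hyperbolic_pair[OF this] and l = line_span_in[OF v(1) w(1) this dim] below_line[OF this]
  have "span {v} \<noteq> span {w}" using hp(3) span_base[of w "{w}"] by auto
  moreover have "span {v} \<in> points E0 dim (Suc 0)" "span {w} \<in> points E0 dim (Suc 0)"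
    using point_span v w dim by auto
  moreover have "line_through E0 below dim (Suc 0) (span {v}) (span {w}) (span {v, w})"
    unfolding line_through_def using hp(2) l by simp
  ultimately show "coll0 (span {v}) (span {w})" unfolding collinear_def by blast
next
  assume "coll0 (span {v}) (span {w})"
  then obtain l where ne: "span {v} \<noteq> span {w}"
    and "line_through E0 below dim (Suc 0) (span {v}) (span {w}) l"
    unfolding collinear_def by blast
  then have l: "subspace l" "dim l = 2" "below (span {v}) l" "below (span {w}) l"
    by (auto simp: line_through_def between_iff good_def)
  have "v \<noteq> 0" "w \<noteq> 0" using v w subspace_0[OF subspace_perp] by auto
  have vw: "v \<in> l" "w \<in> l" using l(3,4) span_base[of v "{v}"] span_base[of w "{w}"] by (auto simp: below_def)
  have "w \<notin> span {v}"
  proof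
    assume "w \<in> span {v}"
    then have "span {w} \<subseteq> span {v}" by (simp add: span_subset)
    then have "span {w} = span {v}" using subspace_dim_equal[of "span {w}" "span {v}"] \<open>w \<noteq> 0\<close> \<open>v \<noteq> 0\<close> by simp
    then show False using ne by simp
  qed
  then have "dim (span {v, w}) = 2" using \<open>v \<noteq> 0\<close> dim_insert[of w "{v}"] by (simp add: insert_commute)
  then have "span {v, w} = l"
    using subspace_dim_equal[of "span {v, w}" l] l vw by (simp add: span_subset)
  then have perp: "perp l = perp {v, w}" by (metis perp_span)
  show "form v w \<noteq> 0"
  proof
    assume "form v w = 0"
    then have "v \<in> perp l" unfolding perp using form_eq_0_sym by (auto simp: perp_def form_alternating)
    then show False using l(3) span_base[of v "{v}"] \<open>v \<noteq> 0\<close> by (auto simp: below_def)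
  qed
qed

lemma collinear_spanE:
  assumes "coll0 p q" "3 \<le> dim U"
  obtains v w where "v \<in> U" "v \<notin> perp U" "w \<in> U" "w \<notin> perp U" "p = span {v}" "q = span {w}"
    "form v w \<noteq> 0"
proof -
  have "p \<in> points E0 dim (Suc 0)" "q \<in> points E0 dim (Suc 0)"
    using assms by (auto simp: collinear_def)
  then show ?thesis using pointE collinear_span_iff assms that by metis
qed

lemma common_neighbours_E0:
  assumes dim: "3 \<le> dim U"
  shows "common_neighbours E0 below dim (Suc 0)"
  unfolding common_neighbours_def
proof (intro ballI)
  fix p q r assume "p \<in> points E0 dim (Suc 0)" "q \<in> points E0 dim (Suc 0)" "r \<in> points E0 dim (Suc 0)"
  then obtain v w u where vwu: "v \<in> U" "v \<notin> perp U" "p = span {v}" "w \<in> U" "w \<notin> perp U" "q = span {w}"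
    "u \<in> U" "u \<notin> perp U" "r = span {u}" by (metis pointE)
  obtain s where s: "s \<in> U" "form v s \<noteq> 0" "form w s \<noteq> 0" "form u s \<noteq> 0"
    using three_nonvanishing[OF large_field U(1) form_if_not_perp[OF vwu(2)]
        form_if_not_perp[OF vwu(5)] form_if_not_perp[OF vwu(8)]] by blast
  then have "form s v \<noteq> 0" "form s w \<noteq> 0" "form s u \<noteq> 0" using form_eq_0_sym by blast+
  moreover from this have "s \<notin> perp U" using not_perp_if_form vwu(1) by blast
  ultimately show "\<exists>s. coll0 s p \<and> coll0 s q \<and> coll0 s r"
    using vwu s(1) dim by (intro exI[of _ "span {s}"]) (simp add: collinear_span_iff)
qed

text \<open>On the line through \<open>a\<close> and \<open>y\<close>, only \<open>a\<close> is orthogonal to \<open>a\<close> or to \<open>x\<close>, and only \<open>y\<close> is orthogonal to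
  \<open>y\<close> or to \<open>z\<close>. The point \<open>a + y\<close> is a third one.\<close>

lemma squares_coned_E0:
  assumes "3 \<le> dim U"
  shows "squares_coned E0 below dim (Suc 0)"
  unfolding squares_coned_def
proof (intro allI impI)
  fix p q r t
  assume c: "coll0 p r" "coll0 r q" "coll0 p t" "coll0 t q" "\<not> coll0 p q" "\<not> coll0 r t"
  obtain a x y z where v: "a \<in> U" "a \<notin> perp U" "p = span {a}" "x \<in> U" "x \<notin> perp U" "q = span {x}"
    "y \<in> U" "y \<notin> perp U" "r = span {y}" "z \<in> U" "z \<notin> perp U" "t = span {z}"
    using c(1,4) assms by (metis collinear_spanE)
  have f: "form a y \<noteq> 0" "form y x \<noteq> 0" "form a z \<noteq> 0" "form z x \<noteq> 0" "form a x = 0" "form y z = 0"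
    using c v assms by (simp_all add: collinear_span_iff)
  have "form y a \<noteq> 0" using f(1) form_eq_0_sym by blast
  then have s: "form (a + y) a \<noteq> 0" "form (a + y) x \<noteq> 0" "form (a + y) y \<noteq> 0" "form (a + y) z \<noteq> 0"
    using f by (simp_all add: form_simps)
  have "a + y \<in> U" using v U by (simp add: subspace_add)
  moreover have "a + y \<notin> perp U" using not_perp_if_form s(1) v(1) by blast
  ultimately show "\<exists>s. coll0 s p \<and> coll0 s q \<and> coll0 s r \<and> coll0 s t"
    using v s assms by (intro exI[of _ "span {a + y}"]) (simp add: collinear_span_iff)
qed

text \<open>The span of the three vectors has dimension at most \<open>3\<close> and contains a two-dimensional nondegenerate
  subspace, so it is good; the only obstruction is the radical of \<open>U\<close>.\<close>

lemma filled_E0: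
  assumes dim: "4 \<le> dim U" and "v \<in> U" "w \<in> U" "u \<in> U"
    and f: "form v w \<noteq> 0" "form w u \<noteq> 0" "form v u \<noteq> 0"
    and rad: "span {v, w, u} \<inter> perp U = {0}"
  shows "filled0 (span {v}) (span {w}) (span {u})"
proof -
  let ?W = "span {v, w, u}"
  have line: "span {a, b} = ?W \<or> below (span {a, b}) ?W" if "a \<in> {v, w, u}" "b \<in> {v, w, u}" "form a b \<noteq> 0" for a b
  proof -
    have "span {a, b} \<subseteq> ?W" using that by (intro span_mono) auto
    then show ?thesis
      using below_nondegenerate[of "span {a, b}" ?W] hyperbolic_pair(1)[OF that(3)] by auto
  qed
  have "good ?W"
  proof (cases "span {v, w} = ?W")
    case True
    then show ?thesis using good_nondegenerate[of "span {v, w}"] hyperbolic_pair(1)[OF f(1)] by simp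
  next
    case False
    then show ?thesis
      using good_if_below[of "span {v, w}" ?W] line[of v w] f hyperbolic_pair(2)[OF f(1)]
        dim_span_triple_le[of v w u] by simp
  qed
  moreover have "below ?W U"
  proof -
    have "?W \<subseteq> U" using assms U by (simp add: span_subset)
    moreover have "?W \<noteq> U" using dim dim_span_triple_le[of v w u] by auto
    ultimately show ?thesis using rad by (auto simp: below_def)
  qed
  moreover have "below {0} ?W"
    using below_zero[of ?W] hyperbolic_pair(4)[OF f(1)] span_base[of v "{v, w, u}"] by auto
  ultimately have "?W \<in> E0" by (simp add: between_iff)
  moreover have "\<exists>l. line_through E0 below dim (Suc 0) (span {a}) (span {b}) l \<and> (l = ?W \<or> below l ?W)"
    if "a \<in> {v, w, u}" "b \<in> {v, w, u}" "form a b \<noteq> 0" for a b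
  proof -
    have "a \<in> U" "b \<in> U" using that assms by auto
    then have "line_through E0 below dim (Suc 0) (span {a}) (span {b}) (span {a, b})"
      using line_span_in[OF _ _ that(3)] below_line[OF that(3)] hyperbolic_pair(2)[OF that(3)] dim
      by (simp add: line_through_def)
    then show ?thesis using line[OF that] by blast
  qed
  ultimately show ?thesis unfolding filled_def using f by (intro bexI[of _ ?W]) auto
qed

text \<open>If \<open>s\<close> had a nonzero coefficient in a vector of \<open>Rad U \<subseteq> T\<close>, then \<open>s\<close> would be in \<open>T\<close>; and the nondegenerate
  space \<open>\<langle>v, w\<rangle>\<close> contains no nonzero vector of \<open>Rad U\<close>.\<close>

lemma cone_avoids_radical:
  assumes "subspace T" "v \<in> T" "w \<in> T" "v \<in> U" "w \<in> U" "form v w \<noteq> 0" "s \<in> U" "s \<notin> T" "Rad U \<subseteq> T"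
  shows "span {v, w, s} \<inter> perp U = {0}"
proof -
  have "z = 0" if z: "z \<in> span {v, w, s}" "z \<in> perp U" for z
  proof -
    obtain a b c where abc: "z = scale a v + (scale b w + scale c s)"
      using z(1) by (auto simp: in_span_triple_iff)
    have "span {v, w, s} \<subseteq> U" using assms U by (simp add: span_subset)
    then have zT: "z \<in> T" using z assms(9) by (auto simp: Rad_def)
    have "c = 0"
    proof (rule ccontr)
      assume "c \<noteq> 0"
      then have "s = scale (inverse c) (z - scale a v - scale b w)" using abc by (simp add: algebra_simps)
      then show False using assms zT by (simp add: subspace_scale subspace_diff)
    qed
    then have "z \<in> span {v, w}" using abc by (auto simp: in_span_pair_iff)
    moreover have "z \<in> perp {v, w}" using z(2) assms by (auto simp: perp_def)
    ultimately show ?thesis using hyperbolic_pair(1)[OF assms(6)] by auto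
  qed
  then show ?thesis using subspace_0[OF subspace_span, of "{v, w, s}"] subspace_0[OF subspace_perp, of U] by blast
qed

text \<open>Here \<open>\<langle>v, w, u\<rangle> = \<langle>v, w\<rangle> \<oplus> Rad U\<close>. A vector with nonzero products with \<open>v\<close>, \<open>w\<close>, \<open>u\<close> can be moved out
  of this space by a vector \<open>e\<close> orthogonal to \<open>v\<close> and \<open>w\<close>, hence to \<open>u\<close>; for dimension reasons
  \<open>e\<close> can be chosen outside \<open>Rad U\<close>.\<close>

lemma triangle_apex:
  assumes dim: "4 \<le> dim U" and vwu: "v \<in> U" "w \<in> U" "u \<in> U"
    and f: "form v w \<noteq> 0" "form w u \<noteq> 0" "form v u \<noteq> 0"
    and rad: "span {v, w, u} \<inter> perp U \<noteq> {0}"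
  shows "\<exists>s\<in>U. s \<notin> span {v, w, u} \<and> form v s \<noteq> 0 \<and> form w s \<noteq> 0 \<and> form u s \<noteq> 0"
    "Rad U \<subseteq> span {v, w, u}"
proof -
  let ?T = "span {v, w, u}"
  have "?T \<subseteq> U" using vwu U by (simp add: span_subset)
  moreover have "0 \<in> ?T \<inter> perp U" by (simp add: subspace_0 span_zero)
  ultimately obtain z where z: "z \<in> ?T" "z \<in> perp U" "z \<noteq> 0" "z \<in> U" using rad by blast
  have "z \<in> Rad U" using z by (simp add: Rad_def)
  then have Rz: "span {z} = Rad U"
    using subspace_dim_equal[of "span {z}" "Rad U"] U z(3) by (simp add: span_subset)
  then show "Rad U \<subseteq> ?T" using z(1) span_subset[of ?T "{z}"] by simp
  note hp = hyperbolic_pair[OF f(1)]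
  have zL: "z \<notin> span {v, w}"
  proof
    assume "z \<in> span {v, w}"
    moreover have "z \<in> perp {v, w}" using z(2) vwu by (auto simp: perp_def)
    ultimately show False using hp(1) z(3) by auto
  qed
  have "?T = span {v, w, z}"
  proof -
    have "span {v, w, z} \<subseteq> ?T" using z(1) by (intro span_subset) (auto simp: span_base)
    moreover have "dim (span {v, w, z}) = 3"
      using dim_insert[of z "{v, w}"] zL hp(2) by (simp add: insert_commute)
    ultimately show ?thesis
      using subspace_dim_equal[of "span {v, w, z}" ?T] dim_span_triple_le[of v w u] by simp
  qed
  then obtain a b c where u: "u = scale a v + (scale b w + scale c z)"
    using span_base[of u "{v, w, u}"] by (auto simp: in_span_triple_iff)
  have "\<not> U \<inter> perp {v, w} \<subseteq> Rad U"
  proof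
    assume "U \<inter> perp {v, w} \<subseteq> Rad U"
    then have "dim (U \<inter> perp {v, w}) \<le> 1" using dim_subset U(2) by (meson order_trans)
    moreover have "dim U \<le> card {v, w} + dim (U \<inter> perp {v, w})" using dim_perp_finite[OF U(1)] by simp
    moreover have "card {v, w} \<le> 2" by (simp add: card_insert_if)
    ultimately show False using dim by simp
  qed
  then obtain e where e: "e \<in> U" "form v e = 0" "form w e = 0" "e \<notin> Rad U" by (auto simp: perp_def)
  have "form z e = 0" using z(2) e(1) form_eq_0_sym by (auto simp: perp_def)
  then have ue: "form u e = 0" using u e by (simp add: form_simps)
  have eT: "e \<notin> ?T"
  proof
    assume "e \<in> ?T"
    then obtain a b c where abc: "e = scale a v + (scale b w + scale c z)"
      using \<open>?T = span {v, w, z}\<close> by (auto simp: in_span_triple_iff)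
    define x where "x = scale a v + scale b w"
    have ex: "e = x + scale c z" using abc by (simp add: x_def add.assoc)
    have "form v z = 0" "form w z = 0" using z(2) vwu by (auto simp: perp_def)
    then have "form v x = 0" "form w x = 0" using e(2,3) ex by (simp_all add: form_simps)
    then have "x \<in> perp (span {v, w})" by (simp add: perp_def[of "{v, w}"])
    moreover have "x \<in> span {v, w}" by (auto simp: x_def in_span_pair_iff)
    ultimately have "x = 0" using hp(1) by blast
    then show False using ex e(4) \<open>z \<in> Rad U\<close> U subspace_scale[OF subspace_Rad] by simp
  qed
  have "v \<notin> perp U" "w \<notin> perp U" "u \<notin> perp U"
    using not_perp_if_form f vwu form_eq_0_sym by metis+
  then obtain s where s: "s \<in> U" "form v s \<noteq> 0" "form w s \<noteq> 0" "form u s \<noteq> 0"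
    using three_nonvanishing[OF large_field U(1) form_if_not_perp form_if_not_perp form_if_not_perp, of v w u] by blast
  show "\<exists>s\<in>U. s \<notin> span {v, w, u} \<and> form v s \<noteq> 0 \<and> form w s \<noteq> 0 \<and> form u s \<noteq> 0"
  proof (cases "s \<in> ?T")
    case False
    then show ?thesis using s by blast
  next
    case True
    have "s + e \<notin> ?T"
    proof
      assume "s + e \<in> ?T"
      then have "s + e - s \<in> ?T" using True by (intro span_diff)
      then show False using eT by simp
    qed
    then show ?thesis using s e ue subspace_add[OF U(1) s(1) e(1)]
      by (intro bexI[of _ "s + e"]) (simp_all add: form_simps)
  qed
qed

lemma triangles_filled_E0:
  assumes dim: "4 \<le> dim U"
  shows "triangles_filled E0 below dim (Suc 0)"
  unfolding triangles_filled_def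
proof (intro allI impI)
  fix p q r assume c: "coll0 p q" "coll0 q r" "coll0 p r"
  have dim3: "3 \<le> dim U" using dim by simp
  obtain v w where vw: "v \<in> U" "v \<notin> perp U" "w \<in> U" "w \<notin> perp U" "p = span {v}" "q = span {w}"
    using collinear_spanE[OF c(1) dim3] by metis
  obtain u where u: "u \<in> U" "u \<notin> perp U" "r = span {u}"
    using c(2) pointE unfolding collinear_def by metis
  have f: "form v w \<noteq> 0" "form w u \<noteq> 0" "form v u \<noteq> 0"
    using c vw u dim3 by (simp_all add: collinear_span_iff)
  let ?T = "span {v, w, u}"
  show "filled0 p q r \<or> (\<exists>s. coll0 p s \<and> coll0 q s \<and> coll0 r s
      \<and> filled0 p q s \<and> filled0 q r s \<and> filled0 p r s)"
  proof (cases "?T \<inter> perp U = {0}")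
    case True
    then show ?thesis using filled_E0[OF dim] vw u f by blast
  next
    case False
    note apex = triangle_apex[OF dim vw(1,3) u(1) f False]
    obtain s where s: "s \<in> U" "s \<notin> ?T" "form v s \<noteq> 0" "form w s \<noteq> 0" "form u s \<noteq> 0"
      using apex(1) by blast
    have sp: "s \<notin> perp U" using not_perp_if_form[OF vw(1)] s(3) form_eq_0_sym by metis
    have T: "subspace ?T" "v \<in> ?T" "w \<in> ?T" "u \<in> ?T" by (auto simp: span_base)
    have "filled0 p q (span {s})"
      using filled_E0[OF dim vw(1,3) s(1) f(1) s(4,3)]
        cone_avoids_radical[OF T(1,2,3) vw(1,3) f(1) s(1,2) apex(2)] vw by simp
    moreover have "filled0 q r (span {s})"
      using filled_E0[OF dim vw(3) u(1) s(1) f(2) s(5,4)]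
        cone_avoids_radical[OF T(1,3,4) vw(3) u(1) f(2) s(1,2) apex(2)] vw u by simp
    moreover have "filled0 p r (span {s})"
      using filled_E0[OF dim vw(1) u(1) s(1) f(3) s(5,3)]
        cone_avoids_radical[OF T(1,2,4) vw(1) u(1) f(3) s(1,2) apex(2)] vw u by simp
    moreover have "coll0 p (span {s})" "coll0 q (span {s})" "coll0 r (span {s})"
      using vw u s sp dim3 by (simp_all add: collinear_span_iff)
    ultimately show ?thesis by blast
  qed
qed

lemma point_exists_E0:
  assumes "2 \<le> dim U"
  shows "points E0 dim (Suc 0) \<noteq> {}"
proof -
  have "\<not> U \<subseteq> Rad U"
  proof
    assume "U \<subseteq> Rad U"
    then have "dim U \<le> dim (Rad U)" by (rule dim_subset)
    then show False using assms U by simp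
  qed
  then obtain v where "v \<in> U" "v \<notin> perp U" by (auto simp: Rad_def)
  then show ?thesis using point_span assms by blast
qed

end

section \<open>Intervals above a one-dimensional space\<close>

text \<open>The interval between \<open>\<langle>r\<rangle>\<close> and \<open>U\<close>.\<close>

locale good_subspace_with_vector = good_subspace +
  fixes r
  assumes r: "r \<in> U" "r \<notin> perp U"
begin

abbreviation "E1 \<equiv> between (span {r}) U"
abbreviation "coll1 \<equiv> collinear E1 below dim (Suc (Suc 0))"
abbreviation "filled1 \<equiv> filled E1 below dim (Suc (Suc 0))"

text \<open>\<open>H\<close> is the space of differences of vectors \<open>v\<close> with \<open>form r v = 1\<close>, and \<open>S\<close> is its radical
  (\<open>form_H_if_notin_S\<close> and \<open>notin_S_if_form\<close>).\<close>

definition "H = U \<inter> perp {r}"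
definition "S = span (insert r (Rad U))"

lemma r_nonzero: "r \<noteq> 0"
  using r subspace_0[OF subspace_perp] by auto

lemma subspace_H: "subspace H"
  unfolding H_def using U by (simp add: subspace_inter)

lemma in_H_iff: "a \<in> H \<longleftrightarrow> a \<in> U \<and> form r a = 0"
  by (auto simp: H_def perp_def)

lemma in_S_iff: "x \<in> S \<longleftrightarrow> (\<exists>k y. y \<in> Rad U \<and> x = scale k r + y)"
proof -
  have "span (Rad U) = Rad U" using U by simp
  show ?thesis unfolding S_def in_span_insert_iff \<open>span (Rad U) = Rad U\<close> by blast
qed

lemma subspace_S: "subspace S"
  by (simp add: S_def)

lemma S_minus: "x - y \<in> S \<longleftrightarrow> y - x \<in> S"
  using subspace_neg[OF subspace_S, of "x - y"] subspace_neg[OF subspace_S, of "y - x"] by auto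

lemma form_r_span: "\<exists>e\<in>U. form r e = 1"
proof -
  obtain x where x: "x \<in> U" "form r x \<noteq> 0" using form_if_not_perp r by blast
  then have "scale (inverse (form r x)) x \<in> U" "form r (scale (inverse (form r x)) x) = 1"
    using U by (simp_all add: subspace_scale form_simps)
  then show ?thesis by blast
qed

text \<open>If \<open>a\<close> is orthogonal to \<open>H\<close>, a hyperplane in \<open>U\<close>, then on \<open>U\<close> the functionals of \<open>a\<close> and
  \<open>r\<close> are proportional, so a multiple of \<open>r\<close> differs from \<open>a\<close> by an element of \<open>Rad U\<close>.\<close>

lemma form_H_if_notin_S:
  assumes a: "a \<in> H" "a \<notin> S"
  shows "\<exists>c\<in>H. form a c \<noteq> 0"
proof (rule ccontr)
  assume "\<not> (\<exists>c\<in>H. form a c \<noteq> 0)"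
  then have H0: "form a c = 0" if "c \<in> H" for c using that by blast
  obtain e where e: "e \<in> U" "form r e = 1" using form_r_span by blast
  define b where "b = a - scale (form a e) r"
  have "form b y = 0" if y: "y \<in> U" for y
  proof -
    have "y - scale (form r y) e \<in> H"
      using y e U by (simp add: in_H_iff subspace_diff subspace_scale form_simps)
    then have "form a (y - scale (form r y) e) = 0" by (rule H0)
    then show ?thesis by (simp add: b_def form_simps)
  qed
  then have "b \<in> perp U" using form_eq_0_sym by (auto simp: perp_def)
  moreover have "b \<in> U" using a r U by (simp add: b_def in_H_iff subspace_diff subspace_scale)
  ultimately have "b \<in> Rad U" by (simp add: Rad_def)
  then have "a \<in> S" unfolding in_S_iff by (intro exI[of _ "form a e"] exI[of _ b]) (simp add: b_def)
  then show False using a by simp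
qed

lemma notin_S_if_form:
  assumes "c \<in> H" "form a c \<noteq> 0"
  shows "a \<notin> S"
proof
  assume "a \<in> S"
  then obtain k y where y: "y \<in> Rad U" "a = scale k r + y" by (auto simp: in_S_iff)
  have "form y c = 0" using y assms form_eq_0_sym by (auto simp: Rad_def perp_def in_H_iff)
  then show False using assms y by (simp add: form_simps in_H_iff)
qed

text \<open>If \<open>a\<close> is not orthogonal to \<open>d\<close>, neither \<open>a\<close> nor \<open>a - d\<close> is orthogonal to \<open>d\<close>, so neither is in
  the radical \<open>S\<close> of \<open>H\<close>. The differences that are in \<open>S\<close> impose only \<open>a \<notin> S\<close>.\<close>

lemma avoid_S:
  assumes dim: "4 \<le> dim U" and d: "d1 \<in> H" "d2 \<in> H"
  shows "\<exists>a\<in>H. a \<notin> S \<and> a - d1 \<notin> S \<and> a - d2 \<notin> S"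
proof -
  have shift: "a - d \<notin> S" if "a \<notin> S" "d \<in> S" for a d
    using subspace_add[OF subspace_S, of "a - d" d] that by auto
  have direct: "a \<notin> S" "a - d \<notin> S" if "a \<in> H" "d \<in> H" "form d a \<noteq> 0" for a d
  proof -
    have "form a d \<noteq> 0" using that form_eq_0_sym by blast
    then show "a \<notin> S" "a - d \<notin> S"
      using notin_S_if_form[of d a] notin_S_if_form[of d "a - d"] that by (simp_all add: form_simps)
  qed
  consider "d1 \<in> S" "d2 \<in> S" | "d1 \<notin> S" "d2 \<in> S" | "d1 \<in> S" "d2 \<notin> S" | "d1 \<notin> S" "d2 \<notin> S" by blast
  then show ?thesis
  proof cases
    case 1
    have "dim U \<le> Suc (dim H)" unfolding H_def using dim_hyperplane U by blast
    moreover have "dim S \<le> Suc (dim (Rad U))" unfolding S_def by (simp add: dim_insert)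
    ultimately have "dim S < dim H" using dim U by simp
    then have "\<not> H \<subseteq> S" using dim_subset[of H S] by auto
    then show ?thesis using shift 1 by blast
  next
    case 2
    then show ?thesis using form_H_if_notin_S[OF d(1)] direct[OF _ d(1)] shift by blast
  next
    case 3
    then show ?thesis using form_H_if_notin_S[OF d(2)] direct[OF _ d(2)] shift by blast
  next
    case 4
    then obtain a where "a \<in> H" "form d1 a \<noteq> 0" "form d2 a \<noteq> 0"
      using two_nonvanishing[OF subspace_H] form_H_if_notin_S d by metis
    then show ?thesis using direct d by blast
  qed
qed

lemma point_over:
  assumes v: "v \<in> U" "form r v = 1" and dim: "3 \<le> dim U"
  shows "span {r, v} \<in> points E1 dim (Suc (Suc 0))"
proof -
  have rv: "form r v \<noteq> 0" using v by simp
  then show ?thesis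
    using line_span_in[OF r(1) v(1) rv dim] below_line(1)[OF rv] hyperbolic_pair(2)[OF rv]
    by (simp add: points_def between_iff)
qed

lemma point_overE:
  assumes "Z \<in> points E1 dim (Suc (Suc 0))"
  obtains v where "v \<in> U" "form r v = 1" "Z = span {r, v}"
proof -
  have Z: "subspace Z" "below (span {r}) Z" "below Z U" "dim Z = 2"
    using assms by (auto simp: points_def between_iff good_def)
  have rZ: "r \<in> Z" "r \<notin> perp Z"
    using Z(2) r_nonzero span_base[of r "{r}"] by (auto simp: below_def)
  then obtain x where x: "x \<in> Z" "form r x \<noteq> 0" using form_if_not_perp by blast
  define v where "v = scale (inverse (form r x)) x"
  have v: "v \<in> Z" "form r v = 1" using x Z(1) by (simp_all add: v_def subspace_scale form_simps)
  have "span {r, v} = Z"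
    using subspace_dim_equal[of "span {r, v}" Z] hyperbolic_pair(2)[of r v] Z v rZ
    by (simp add: span_subset)
  moreover have "v \<in> U" using v Z(3) by (auto simp: below_def)
  ultimately show ?thesis using v that by blast
qed

lemma line_over:
  assumes v: "v \<in> U" "form r v = 1" and w: "w \<in> U" "form r w = 1"
    and S: "w - v \<notin> S" and dim: "4 \<le> dim U"
  shows "line_through E1 below dim (Suc (Suc 0)) (span {r, v}) (span {r, w}) (span {r, v, w})"
    "span {r, v} \<noteq> span {r, w}"
proof -
  let ?l = "span {r, v, w}"
  have rv: "form r v \<noteq> 0" and rw: "form r w \<noteq> 0" using v w by simp_all
  have "w \<notin> span {r, v}"
  proof
    assume "w \<in> span {r, v}"
    then obtain a b where ab: "w = scale a r + scale b v" by (auto simp: in_span_pair_iff)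
    then have "b = 1" using v w by (simp add: form_simps)
    then have "w - v = scale a r + 0" using ab by simp
    then show False using S subspace_0[OF subspace_Rad[OF U(1)]] in_S_iff by blast
  qed
  then show "span {r, v} \<noteq> span {r, w}" using span_base[of w "{r, w}"] by auto
  have d: "dim ?l = 3"
    using dim_insert[of w "{r, v}"] \<open>w \<notin> span {r, v}\<close> hyperbolic_pair(2)[OF rv]
    by (simp add: insert_commute)
  have sub: "?l \<subseteq> U" using r v w U by (simp add: span_subset)
  have "z = 0" if z: "z \<in> ?l" "z \<in> perp U" for z
  proof -
    obtain a b c where abc: "z = scale a r + (scale b v + scale c w)"
      using z(1) by (auto simp: in_span_triple_iff)
    have "form r z = 0" using z(2) r by (auto simp: perp_def)
    then have "b + c = 0" using abc v w by (simp add: form_simps)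
    then have "b = - c" by (simp add: eq_neg_iff_add_eq_0)
    then have zc: "z = scale a r + scale c (w - v)" using abc by (simp add: algebra_simps)
    have "c = 0"
    proof (rule ccontr)
      assume "c \<noteq> 0"
      then have "w - v = scale (inverse c) (z - scale a r)" using zc by simp
      also have "\<dots> = scale (- inverse c * a) r + scale (inverse c) z" by (simp add: algebra_simps)
      finally have "w - v = scale (- inverse c * a) r + scale (inverse c) z" .
      moreover have "z \<in> Rad U" using z sub by (auto simp: Rad_def)
      then have "scale (inverse c) z \<in> Rad U" by (rule subspace_scale[OF subspace_Rad[OF U(1)]])
      ultimately show False using S in_S_iff by blast
    qed
    then have "z \<in> span {r}" "z \<in> perp {v}" using zc z(2) v by (auto simp: in_span_singleton_iff perp_def)
    then have "a = 0" using zc \<open>c = 0\<close> rv form_eq_0_sym[of r v] by (simp add: perp_def form_simps)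
    then show ?thesis using zc \<open>c = 0\<close> by simp
  qed
  then have "?l \<inter> perp U = {0}"
    using subspace_0[OF subspace_span, of "{r, v, w}"] subspace_0[OF subspace_perp, of U] by blast
  moreover have "?l \<noteq> U" using d dim by auto
  ultimately have lU: "below ?l U" using sub by (auto simp: below_def)
  have below: "below (span {r, x}) ?l" if "x \<in> {v, w}" "form r x \<noteq> 0" for x
  proof -
    have "span {r, x} \<subseteq> ?l" using that by (intro span_mono) auto
    moreover have "span {r, x} \<noteq> ?l"
    proof
      assume eq: "span {r, x} = ?l"
      show False using d hyperbolic_pair(2)[OF that(2)] unfolding eq[symmetric] by simp
    qed
    ultimately show ?thesis
      using below_nondegenerate[of "span {r, x}" ?l] hyperbolic_pair(1)[OF that(2)] by auto
  qed
  have "good ?l"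
    using good_if_below[of "span {r, v}" ?l] below[of v] rv d hyperbolic_pair(2)[OF rv] by simp
  moreover have "below (span {r}) ?l" using below_trans[OF below_line(1)[OF rv] below[of v]] rv by simp
  ultimately show "line_through E1 below dim (Suc (Suc 0)) (span {r, v}) (span {r, w}) ?l"
    unfolding line_through_def between_iff using lU below rv rw d by simp
qed

text \<open>A line through both points contains \<open>w - v\<close> and meets \<open>Rad U\<close> trivially. If \<open>w - v\<close> is in
  \<open>\<langle>r\<rangle> + Rad U\<close>, its component in \<open>Rad U\<close> lies in the line as well and so vanishes, and the two points
  coincide.\<close>

lemma collinear_over_iff:
  assumes v: "v \<in> U" "form r v = 1" and w: "w \<in> U" "form r w = 1" and dim: "4 \<le> dim U"
  shows "coll1 (span {r, v}) (span {r, w}) \<longleftrightarrow> w - v \<notin> S"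
proof
  assume "w - v \<notin> S"
  then show "coll1 (span {r, v}) (span {r, w})"
    unfolding collinear_def using line_over[OF v w _ dim] point_over[OF v] point_over[OF w] dim by auto
next
  assume "coll1 (span {r, v}) (span {r, w})"
  then obtain l where ne: "span {r, v} \<noteq> span {r, w}"
    and "line_through E1 below dim (Suc (Suc 0)) (span {r, v}) (span {r, w}) l"
    unfolding collinear_def by blast
  then have l: "subspace l" "below l U" "span {r, v} \<subseteq> l" "span {r, w} \<subseteq> l"
    by (auto simp: line_through_def between_iff good_def below_def)
  have in_l: "r \<in> l" "v \<in> l" "w \<in> l"
    using l(3,4) span_base[of r "{r, v}"] span_base[of v "{r, v}"] span_base[of w "{r, w}"] by auto
  show "w - v \<notin> S"
  proof
    assume "w - v \<in> S"
    then obtain k y where y: "y \<in> Rad U" "w - v = scale k r + y" by (auto simp: in_S_iff)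
    have "y = w - v - scale k r" using y(2) by simp
    then have "y \<in> l" using in_l l(1) by (simp add: subspace_diff subspace_scale)
    then have "y = 0" using y(1) l(2) by (auto simp: Rad_def below_def)
    then have w_eq: "w = scale k r + scale 1 v" and v_eq: "v = scale (- k) r + scale 1 w"
      using y(2) by (simp_all add: algebra_simps)
    have "w \<in> span {r, v}" unfolding in_span_pair_iff using w_eq by blast
    moreover have "v \<in> span {r, w}" unfolding in_span_pair_iff using v_eq by blast
    ultimately have "span {r, v} = span {r, w}"
      by (intro subset_antisym span_subset) (auto simp: span_base)
    then show False using ne by simp
  qed
qed

lemma common_neighbours_E1:
  assumes dim: "4 \<le> dim U"
  shows "common_neighbours E1 below dim (Suc (Suc 0))"
  unfolding common_neighbours_def
proof (intro ballI)
  fix p1 p2 p3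
  assume "p1 \<in> points E1 dim (Suc (Suc 0))" "p2 \<in> points E1 dim (Suc (Suc 0))"
    "p3 \<in> points E1 dim (Suc (Suc 0))"
  then obtain v w u where vwu: "v \<in> U" "form r v = 1" "p1 = span {r, v}"
    "w \<in> U" "form r w = 1" "p2 = span {r, w}" "u \<in> U" "form r u = 1" "p3 = span {r, u}"
    by (metis point_overE)
  have "w - v \<in> H" "u - v \<in> H" using vwu U by (simp_all add: in_H_iff subspace_diff form_simps)
  then obtain a where a: "a \<in> H" "a \<notin> S" "a - (w - v) \<notin> S" "a - (u - v) \<notin> S"
    using avoid_S[OF dim] by blast
  define s where "s = v + a"
  have s: "s \<in> U" "form r s = 1"
    using vwu a U by (simp_all add: s_def in_H_iff subspace_add form_simps)
  have "a = s - v" "a - (w - v) = s - w" "a - (u - v) = s - u" by (simp_all add: s_def)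
  then have "s - v \<notin> S" "s - w \<notin> S" "s - u \<notin> S" using a by metis+
  then have "v - s \<notin> S" "w - s \<notin> S" "u - s \<notin> S" using S_minus by blast+
  then show "\<exists>s. coll1 s p1 \<and> coll1 s p2 \<and> coll1 s p3"
    using vwu s dim by (intro exI[of _ "span {r, s}"]) (simp add: collinear_over_iff)
qed

text \<open>Opposite vertices are congruent modulo \<open>S\<close>, so a point collinear with two adjacent vertices is
  collinear with all four.\<close>

lemma squares_coned_E1:
  assumes dim: "4 \<le> dim U"
  shows "squares_coned E1 below dim (Suc (Suc 0))"
  unfolding squares_coned_def
proof (intro allI impI)
  fix p1 p2 p3 p4
  assume c: "coll1 p1 p3" "coll1 p3 p2" "coll1 p1 p4" "coll1 p4 p2" "\<not> coll1 p1 p2" "\<not> coll1 p3 p4"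
  have "p1 \<in> points E1 dim (Suc (Suc 0))" "p2 \<in> points E1 dim (Suc (Suc 0))"
    "p3 \<in> points E1 dim (Suc (Suc 0))" "p4 \<in> points E1 dim (Suc (Suc 0))"
    using c(1,4) by (simp_all add: collinear_def)
  then obtain a x y z where v: "a \<in> U" "form r a = 1" "p1 = span {r, a}"
    "x \<in> U" "form r x = 1" "p2 = span {r, x}" "y \<in> U" "form r y = 1" "p3 = span {r, y}"
    "z \<in> U" "form r z = 1" "p4 = span {r, z}" by (metis point_overE)
  have xa: "x - a \<in> S" and zy: "z - y \<in> S" using c(5,6) v dim by (simp_all add: collinear_over_iff)
  have "y - a \<in> H" using v U by (simp add: in_H_iff subspace_diff form_simps)
  then obtain e where e: "e \<in> H" "e \<notin> S" "e - (y - a) \<notin> S" using avoid_S[OF dim] by blast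
  define s where "s = a + e"
  have s: "s \<in> U" "form r s = 1"
    using v e U by (simp_all add: s_def in_H_iff subspace_add form_simps)
  have S_shift: "u - d \<notin> S" if "u \<notin> S" "d \<in> S" for u d
    using subspace_add[OF subspace_S, of "u - d" d] that by auto
  have "e = s - a" "e - (y - a) = s - y" "e - (x - a) = s - x" "e - (y - a) - (z - y) = s - z"
    by (simp_all add: s_def)
  then have "s - a \<notin> S" "s - y \<notin> S" "s - x \<notin> S" "s - z \<notin> S"
    using e S_shift[OF e(2) xa] S_shift[OF e(3) zy] by metis+
  then have "a - s \<notin> S" "x - s \<notin> S" "y - s \<notin> S" "z - s \<notin> S" using S_minus by blast+
  then show "\<exists>s. coll1 s p1 \<and> coll1 s p2 \<and> coll1 s p3 \<and> coll1 s p4"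
    using v s dim by (intro exI[of _ "span {r, s}"]) (simp add: collinear_over_iff)
qed

text \<open>Under the assumption \<open>w - v\<close> and \<open>u - v\<close> span a two-dimensional nondegenerate subspace of the orthogonal
  of \<open>r\<close>. Together with the hyperbolic pair \<open>r\<close>, \<open>v\<close> this makes \<open>\<langle>r, v, w, u\<rangle>\<close> nondegenerate.\<close>

lemma filled_E1:
  assumes dim: "5 \<le> dim U" and v: "v \<in> U" "form r v = 1" and w: "w \<in> U" "form r w = 1"
    and u: "u \<in> U" "form r u = 1" and f: "form (w - v) (u - v) \<noteq> 0"
  shows "filled1 (span {r, v}) (span {r, w}) (span {r, u})"
proof -
  let ?W = "span {r, v, w, u}"
  have rv: "form r v \<noteq> 0" using v by simp
  have "z = 0" if z: "z \<in> ?W" "z \<in> perp {r, v, w, u}" for z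
  proof -
    obtain a b c d where "z = scale a r + (scale b v + (scale c w + scale d u))"
      using z(1) unfolding in_span_insert_iff[of z r] in_span_triple_iff by blast
    moreover have z0: "form r z = 0" "form v z = 0" "form w z = 0" "form u z = 0"
      using z(2) by (auto simp: perp_def)
    ultimately have "b + (c + d) = 0" using v w u by (simp add: form_simps)
    then have "b = - (c + d)" by (simp only: eq_neg_iff_add_eq_0)
    then have zcd: "z = scale a r + (scale c (w - v) + scale d (u - v))"
      unfolding \<open>z = _\<close> \<open>b = _\<close> by (simp add: algebra_simps)
    \<comment> \<open>Pairing \<open>z\<close> with \<open>r\<close>, \<open>w - v\<close>, \<open>u - v\<close> and \<open>v\<close> in turn kills its coefficients.\<close>
    have vr: "form v r = - 1" "form w r = - 1" "form u r = - 1"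
      using form_antisym[of v r] form_antisym[of w r] form_antisym[of u r] v w u by simp_all
    have "form (w - v) z = 0" "form (u - v) z = 0" using z0 by (simp_all add: form_diff_left)
    moreover have "form (w - v) z = d * form (w - v) (u - v)"
      unfolding zcd form_add_right form_scale_right form_alternating
      by (simp add: form_diff_left[of w v r] vr)
    moreover have "form (u - v) z = c * form (u - v) (w - v)"
      unfolding zcd form_add_right form_scale_right form_alternating
      by (simp add: form_diff_left[of u v r] vr)
    ultimately have "d = 0" "c = 0" using f form_eq_0_sym[of "w - v" "u - v"] by simp_all
    then have "a = 0" using zcd z0(2) vr by (simp add: form_simps)
    then show ?thesis using zcd \<open>d = 0\<close> \<open>c = 0\<close> by simp
  qed
  then have W: "?W \<inter> perp ?W = {0}"
    using subspace_0[OF subspace_span, of "{r, v, w, u}"]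
      subspace_0[OF subspace_perp, of "{r, v, w, u}"] by auto
  have below_W: "l = ?W \<or> below l ?W" if "subspace l" "l \<subseteq> ?W" for l
    using below_nondegenerate[of l ?W] that W by auto
  have "?W \<subseteq> U" using r v w u U by (simp add: span_subset)
  moreover have "?W \<noteq> U" using dim dim_span_quadruple_le[of r v w u] by auto
  ultimately have "below ?W U" using below_nondegenerate[of ?W U] U W by auto
  moreover have "below (span {r}) ?W"
  proof -
    have "span {r, v} \<subseteq> ?W" by (intro span_mono) auto
    then have "span {r, v} = ?W \<or> below (span {r, v}) ?W" using below_W by simp
    then show ?thesis using below_line(1)[OF rv] below_trans by metis
  qed
  ultimately have "?W \<in> E1" using good_nondegenerate[of ?W] W by (simp add: between_iff)
  moreover have "\<exists>l. line_through E1 below dim (Suc (Suc 0)) (span {r, a}) (span {r, b}) l \<and> (l = ?W \<or> below l ?W)"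
    if "a \<in> {v, w, u}" "b \<in> {v, w, u}" "b - a \<notin> S" for a b
  proof -
    have "a \<in> U" "b \<in> U" "form r a = 1" "form r b = 1" using that v w u by auto
    then have "line_through E1 below dim (Suc (Suc 0)) (span {r, a}) (span {r, b}) (span {r, a, b})"
      using line_over(1) that(3) dim by simp
    moreover have "span {r, a, b} \<subseteq> ?W" using that by (intro span_mono) auto
    ultimately show ?thesis using below_W by auto
  qed
  moreover have "w - v \<notin> S" "u - v \<notin> S" "u - w \<notin> S"
  proof -
    have H: "w - v \<in> H" "u - v \<in> H" using v w u U by (simp_all add: in_H_iff subspace_diff form_simps)
    show "w - v \<notin> S" using notin_S_if_form H f by blast
    have f': "form (u - v) (w - v) \<noteq> 0" using f form_eq_0_sym by blast
    then show "u - v \<notin> S" using notin_S_if_form H by blast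
    have "form (u - w) (w - v) = form (u - v) (w - v) - form (w - v) (w - v)"
      unfolding form_diff_left[symmetric] by simp
    then have "form (u - w) (w - v) \<noteq> 0" using f' by (simp only: form_alternating) simp
    then show "u - w \<notin> S" using notin_S_if_form H by blast
  qed
  ultimately show ?thesis unfolding filled_def by (intro bexI[of _ ?W]) auto
qed

text \<open>If \<open>w - v\<close> and \<open>u - v\<close> are orthogonal, then with apex \<open>v + c\<close> the forms that decide about the three lateral
  faces are the products of \<open>c\<close> with \<open>w - v\<close>, \<open>u - w\<close> and \<open>u - v\<close>.\<close>

lemma triangles_filled_E1:
  assumes dim: "5 \<le> dim U"
  shows "triangles_filled E1 below dim (Suc (Suc 0))"
  unfolding triangles_filled_def
proof (intro allI impI)
  fix p1 p2 p3
  assume c: "coll1 p1 p2" "coll1 p2 p3" "coll1 p1 p3"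
  have dim4: "4 \<le> dim U" using dim by simp
  have "p1 \<in> points E1 dim (Suc (Suc 0))" "p2 \<in> points E1 dim (Suc (Suc 0))"
    "p3 \<in> points E1 dim (Suc (Suc 0))" using c by (simp_all add: collinear_def)
  then obtain v w u where vwu: "v \<in> U" "form r v = 1" "p1 = span {r, v}"
    "w \<in> U" "form r w = 1" "p2 = span {r, w}" "u \<in> U" "form r u = 1" "p3 = span {r, u}"
    by (metis point_overE)
  have S: "w - v \<notin> S" "u - w \<notin> S" "u - v \<notin> S"
    using c vwu dim4 by (simp_all add: collinear_over_iff)
  have H: "w - v \<in> H" "u - w \<in> H" "u - v \<in> H"
    using vwu U by (simp_all add: in_H_iff subspace_diff form_simps)
  show "filled1 p1 p2 p3 \<or> (\<exists>s. coll1 p1 s \<and> coll1 p2 s \<and> coll1 p3 s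
      \<and> filled1 p1 p2 s \<and> filled1 p2 p3 s \<and> filled1 p1 p3 s)"
  proof (cases "form (w - v) (u - v) = 0")
    case False
    then show ?thesis using filled_E1[OF dim] vwu by simp
  next
    case True
    obtain c where c: "c \<in> H" "form (w - v) c \<noteq> 0" "form (u - w) c \<noteq> 0" "form (u - v) c \<noteq> 0"
      using three_nonvanishing[OF large_field subspace_H form_H_if_notin_S[OF H(1) S(1)]
          form_H_if_notin_S[OF H(2) S(2)] form_H_if_notin_S[OF H(3) S(3)]] by blast
    define s where "s = v + c"
    have s: "s \<in> U" "form r s = 1" "s - v = c"
      using vwu c U by (simp_all add: s_def in_H_iff subspace_add form_simps)
    have "form (u - w) (s - w) = form (u - w) c"
    proof -
      have "form (u - w) (w - v) = form (u - v) (w - v) - form (w - v) (w - v)"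
        unfolding form_diff_left[symmetric] by simp
      then have "form (u - w) (w - v) = 0"
        using True form_eq_0_sym[of "w - v" "u - v"] by (simp only: form_alternating) simp
      moreover have "s - w = c - (w - v)" by (simp add: s_def)
      ultimately show ?thesis by (simp only: form_diff_right[of "u - w" c "w - v"]) simp
    qed
    then have f: "form (w - v) (s - v) \<noteq> 0" "form (u - w) (s - w) \<noteq> 0" "form (u - v) (s - v) \<noteq> 0"
      using c s(3) by simp_all
    have "s - v \<notin> S" using notin_S_if_form[OF H(1), of "s - v"] f(1) form_eq_0_sym by blast
    moreover have "s - w \<notin> S" using notin_S_if_form[OF H(2), of "s - w"] f(2) form_eq_0_sym by blast
    moreover have "s - u \<notin> S"
    proof -
      have "form (u - v) (s - u) = form (u - v) (s - v) - form (u - v) (u - v)"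
        unfolding form_diff_right[symmetric] by simp
      then have "form (u - v) (s - u) \<noteq> 0" using f(3) by (simp only: form_alternating) simp
      then show ?thesis using notin_S_if_form[OF H(3), of "s - u"] form_eq_0_sym by blast
    qed
    ultimately have "coll1 p1 (span {r, s})" "coll1 p2 (span {r, s})" "coll1 p3 (span {r, s})"
      using vwu s dim4 by (simp_all add: collinear_over_iff)
    moreover have "filled1 p1 p2 (span {r, s})" "filled1 p2 p3 (span {r, s})" "filled1 p1 p3 (span {r, s})"
      using filled_E1[OF dim] vwu s(1,2) f by simp_all
    ultimately show ?thesis by blast
  qed
qed

lemma point_exists_E1:
  assumes "3 \<le> dim U"
  shows "points E1 dim (Suc (Suc 0)) \<noteq> {}"
  using form_r_span point_over assms by blast

end

section \<open>Reduction of an arbitrary interval\<close>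

locale ranked_isomorphism =
  fixes A :: "'o set" and f :: "'o \<Rightarrow> 'o" and lt :: "'o \<Rightarrow> 'o \<Rightarrow> bool" and rk :: "'o \<Rightarrow> nat" and d :: nat
  assumes inj: "inj_on f A"
    and rk_f: "a \<in> A \<Longrightarrow> rk (f a) = rk a + d"
    and lt_f: "a \<in> A \<Longrightarrow> b \<in> A \<Longrightarrow> lt (f a) (f b) \<longleftrightarrow> lt a b"
begin

lemma points_image: "points (f ` A) rk (k + d) = f ` points A rk k"
  unfolding points_def using rk_f by auto

lemma line_through_image:
  assumes "p \<in> A" "q \<in> A" "l \<in> A"
  shows "line_through (f ` A) lt rk (k + d) (f p) (f q) (f l) \<longleftrightarrow> line_through A lt rk k p q l"
  unfolding line_through_def using assms rk_f lt_f by simp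

lemma collinear_image:
  assumes "p \<in> A" "q \<in> A"
  shows "collinear (f ` A) lt rk (k + d) (f p) (f q) \<longleftrightarrow> collinear A lt rk k p q"
proof -
  have "(\<exists>l. line_through (f ` A) lt rk (k + d) (f p) (f q) l) \<longleftrightarrow>
      (\<exists>l\<in>A. line_through (f ` A) lt rk (k + d) (f p) (f q) (f l))"
    unfolding line_through_def by blast
  also have "\<dots> \<longleftrightarrow> (\<exists>l. line_through A lt rk k p q l)"
    using line_through_image[OF assms] unfolding line_through_def by blast
  finally show ?thesis
    using assms rk_f inj by (simp add: collinear_def points_def inj_on_eq_iff)
qed

lemma filled_image:
  assumes "p \<in> A" "q \<in> A" "r \<in> A" and f: "filled A lt rk k p q r"
  shows "filled (f ` A) lt rk (k + d) (f p) (f q) (f r)"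
proof -
  obtain W where W: "W \<in> A" and lines: "\<forall>(a, b) \<in> {(p, q), (q, r), (p, r)}.
     \<exists>l. line_through A lt rk k a b l \<and> (l = W \<or> lt l W)"
    using f unfolding filled_def by blast
  have "\<exists>l. line_through (f ` A) lt rk (k + d) (f a) (f b) l \<and> (l = f W \<or> lt l (f W))"
    if ab: "(a, b) \<in> {(p, q), (q, r), (p, r)}" for a b
  proof -
    obtain l where l: "line_through A lt rk k a b l" "l = W \<or> lt l W" using lines ab by blast
    moreover have "a \<in> A" "b \<in> A" "l \<in> A" using ab assms l by (auto simp: line_through_def)
    ultimately show ?thesis using line_through_image lt_f W by blast
  qed
  then show ?thesis unfolding filled_def using W by (intro bexI[of _ "f W"]) auto
qed

lemma common_neighbours_image:
  assumes "common_neighbours A lt rk k"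
  shows "common_neighbours (f ` A) lt rk (k + d)"
  unfolding common_neighbours_def points_image
proof (intro ballI)
  fix p' q' r' assume "p' \<in> f ` points A rk k" "q' \<in> f ` points A rk k" "r' \<in> f ` points A rk k"
  then obtain p q r where pqr: "p \<in> points A rk k" "q \<in> points A rk k" "r \<in> points A rk k"
    "p' = f p" "q' = f q" "r' = f r" by blast
  then obtain s where s: "collinear A lt rk k s p" "collinear A lt rk k s q" "collinear A lt rk k s r"
    using assms unfolding common_neighbours_def by blast
  then have "s \<in> A" "p \<in> A" "q \<in> A" "r \<in> A" by (auto simp: collinear_def points_def)
  then show "\<exists>s. collinear (f ` A) lt rk (k + d) s p' \<and> collinear (f ` A) lt rk (k + d) s q'
      \<and> collinear (f ` A) lt rk (k + d) s r'"
    using s pqr by (intro exI[of _ "f s"]) (simp add: collinear_image)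
qed

lemma collinear_imageE:
  assumes "collinear (f ` A) lt rk (k + d) p' q'"
  obtains p q where "p \<in> A" "q \<in> A" "p' = f p" "q' = f q"
  using assms unfolding collinear_def points_def by blast

lemma squares_coned_image:
  assumes "squares_coned A lt rk k"
  shows "squares_coned (f ` A) lt rk (k + d)"
  unfolding squares_coned_def
proof (intro allI impI)
  let ?C = "collinear (f ` A) lt rk (k + d)"
  fix a' x' y' z'
  assume c: "?C a' y'" "?C y' x'" "?C a' z'" "?C z' x'" "\<not> ?C a' x'" "\<not> ?C y' z'"
  obtain a y where ay: "a \<in> A" "y \<in> A" "a' = f a" "y' = f y" using c(1) by (rule collinear_imageE)
  obtain z x where zx: "z \<in> A" "x \<in> A" "z' = f z" "x' = f x" using c(4) by (rule collinear_imageE)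
  let ?D = "collinear A lt rk k"
  have "?D a y" "?D y x" "?D a z" "?D z x" "\<not> ?D a x" "\<not> ?D y z"
    using c ay zx by (simp_all add: collinear_image)
  then obtain s where s: "?D s a" "?D s x" "?D s y" "?D s z"
    using assms unfolding squares_coned_def by blast
  then have "s \<in> A" by (auto simp: collinear_def points_def)
  then show "\<exists>s. ?C s a' \<and> ?C s x' \<and> ?C s y' \<and> ?C s z'"
    using s ay zx by (intro exI[of _ "f s"]) (simp add: collinear_image)
qed

lemma triangles_filled_image:
  assumes "triangles_filled A lt rk k"
  shows "triangles_filled (f ` A) lt rk (k + d)"
  unfolding triangles_filled_def
proof (intro allI impI)
  let ?C = "collinear (f ` A) lt rk (k + d)" and ?F = "filled (f ` A) lt rk (k + d)"
  fix p' q' r'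
  assume c: "?C p' q'" "?C q' r'" "?C p' r'"
  obtain p q where pq: "p \<in> A" "q \<in> A" "p' = f p" "q' = f q" using c(1) by (rule collinear_imageE)
  obtain r where r: "r \<in> A" "r' = f r" using c(2) by (rule collinear_imageE)
  have c': "collinear A lt rk k p q" "collinear A lt rk k q r" "collinear A lt rk k p r"
    using c pq r by (simp_all add: collinear_image)
  consider "filled A lt rk k p q r" | s where "collinear A lt rk k p s"
    "collinear A lt rk k q s" "collinear A lt rk k r s" "filled A lt rk k p q s"
    "filled A lt rk k q r s" "filled A lt rk k p r s"
    using assms c' unfolding triangles_filled_def by blast
  then show "?F p' q' r' \<or>
    (\<exists>s. ?C p' s \<and> ?C q' s \<and> ?C r' s \<and> ?F p' q' s \<and> ?F q' r' s \<and> ?F p' r' s)"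
  proof cases
    case 1
    then show ?thesis using filled_image pq r by simp
  next
    case (2 s)
    then have "s \<in> A" by (auto simp: collinear_def points_def)
    then show ?thesis
      using 2 pq r by (intro disjI2 exI[of _ "f s"]) (simp add: collinear_image filled_image)
  qed
qed

end

context symplectic_space
begin

text \<open>Extend a basis of \<open>R\<close> to a basis of \<open>X\<close>; the added vectors span \<open>N\<close>.\<close>

lemma subspace_complement:
  assumes R: "subspace R" "R \<subseteq> X" and X: "subspace X"
  obtains N where "subspace N" "N \<subseteq> X" "N \<inter> R = {0}" "\<And>x. x \<in> X \<Longrightarrow> \<exists>a\<in>N. x - a \<in> R"
proof -
  obtain B where B: "B \<subseteq> R" "independent B" "R \<subseteq> span B" "card B = dim R"
    using basis_exists by blast
  obtain C where C: "B \<subseteq> C" "C \<subseteq> X" "independent C" "X \<subseteq> span C"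
    using maximal_independent_subset_extend[of B X] B R by (metis order_trans)
  have spans: "span B = R" "span C = X"
    using B C R X by (simp_all add: span_subset subset_antisym)
  have fin: "finite C" using C(3) by (rule finiteI_independent)
  define N where "N = span (C - B)"
  have "span C = {x + y |x y. x \<in> N \<and> y \<in> R}"
    using span_Un[of "C - B" B] C(1) spans(1) by (simp add: N_def Un_absorb2)
  then have sums: "X = {x + y |x y. x \<in> N \<and> y \<in> R}" using spans(2) by simp
  have "dim X + dim (N \<inter> R) = dim N + dim R"
    unfolding sums by (rule dim_sums_Int) (simp_all add: N_def R)
  moreover have "dim X = card C" "dim N = card (C - B)" "dim R = card B"
    using dim_span_eq_card_independent independent_mono[OF C(3)] B C spans
    by (metis, metis Diff_subset N_def, metis)
  moreover have "card C = card (C - B) + card B"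
    using card_Diff_subset[OF finite_subset[OF C(1) fin] C(1)] card_mono[OF fin C(1)] by simp
  ultimately have "dim (N \<inter> R) = 0" by simp
  then have "N \<inter> R \<subseteq> {0}" by (simp add: dim_eq_0)
  moreover have "0 \<in> N \<inter> R" using R by (simp add: N_def subspace_0 span_zero)
  moreover have "N \<subseteq> X" using C X unfolding N_def by (intro span_subset) auto
  moreover have "\<exists>a\<in>N. x - a \<in> R" if "x \<in> X" for x
  proof -
    obtain a y where "x = a + y" "a \<in> N" "y \<in> R" using \<open>x \<in> X\<close> sums by blast
    then show ?thesis by (intro bexI[of _ a]) simp_all
  qed
  ultimately show ?thesis using that[of N] by (auto simp: N_def)
qed

end

text \<open>Adding \<open>N\<close> identifies the subspaces of the orthogonal of \<open>N\<close> with the subspaces containing \<open>N\<close>, and it preserves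
  radicals. So an interval above \<open>N\<close> is isomorphic to one inside the orthogonal of \<open>N\<close>.\<close>

locale nondegenerate_part = symplectic_space scale Basis form
  for scale :: "'f::field \<Rightarrow> 'v::ab_group_add \<Rightarrow> 'v" and Basis :: "'v set" and form +
  fixes N :: "'v set"
  assumes N: "subspace N" "N \<inter> perp N = {0}"
begin

definition extend :: "'v set \<Rightarrow> 'v set" where
  "extend S = {x + s |x s. x \<in> N \<and> s \<in> S}"

lemma subspace_extend: "subspace S \<Longrightarrow> subspace (extend S)"
  unfolding extend_def using N by (intro subspace_sums)

lemma extend_superset: "subspace S \<Longrightarrow> N \<subseteq> extend S \<and> S \<subseteq> extend S"
  unfolding extend_def using subspace_0[of S] subspace_0[OF N(1)] by force

lemma extend_Int_perp:
  assumes "S \<subseteq> perp N" "subspace S"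
  shows "extend S \<inter> perp N = S"
proof
  show "S \<subseteq> extend S \<inter> perp N" using assms extend_superset by blast
  show "extend S \<inter> perp N \<subseteq> S"
  proof
    fix z assume z: "z \<in> extend S \<inter> perp N"
    then obtain x s where xs: "x \<in> N" "s \<in> S" "z = x + s" by (auto simp: extend_def)
    then have "z - s \<in> perp N" using z assms by (intro subspace_diff) auto
    then have "x \<in> N \<inter> perp N" using xs by simp
    then show "z \<in> S" using N(2) xs by auto
  qed
qed

lemma extend_Int_perp_extend:
  assumes S: "S \<subseteq> perp N" "subspace S" and S': "S' \<subseteq> perp N" "subspace S'"
  shows "extend S \<inter> perp (extend S') = S \<inter> perp S'"
proof
  have sup: "N \<subseteq> extend S'" "S' \<subseteq> extend S'" using extend_superset S'(2) by auto
  then have "extend S \<inter> perp (extend S') \<subseteq> extend S \<inter> perp N" using perp_antimono by blast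
  then show "extend S \<inter> perp (extend S') \<subseteq> S \<inter> perp S'"
    using extend_Int_perp[OF S] perp_antimono[OF sup(2)] by blast
  show "S \<inter> perp S' \<subseteq> extend S \<inter> perp (extend S')"
  proof
    fix s assume s: "s \<in> S \<inter> perp S'"
    have "s \<in> perp N" using s S by blast
    then have "s \<in> perp (extend S')"
      using s by (auto simp: extend_def perp_def form_simps)
    then show "s \<in> extend S \<inter> perp (extend S')" using s extend_superset[OF S(2)] by blast
  qed
qed

lemma extend_subset_iff:
  assumes S: "S \<subseteq> perp N" "subspace S" and S': "S' \<subseteq> perp N" "subspace S'"
  shows "extend S \<subseteq> extend S' \<longleftrightarrow> S \<subseteq> S'"
proof
  show "extend S \<subseteq> extend S' \<Longrightarrow> S \<subseteq> S'"
    using extend_Int_perp[OF S] extend_Int_perp[OF S'] by blast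
  show "S \<subseteq> S' \<Longrightarrow> extend S \<subseteq> extend S'" unfolding extend_def by blast
qed

lemma dim_extend:
  assumes "S \<subseteq> perp N" "subspace S"
  shows "dim (extend S) = dim S + dim N"
proof -
  have "N \<inter> S = {0}" using assms N subspace_0[of S] subspace_0[of N] by blast
  then show ?thesis using dim_sums_Int[OF N(1) assms(2)] by (simp add: extend_def)
qed

lemma below_extend_iff:
  assumes "S \<subseteq> perp N" "subspace S" "S' \<subseteq> perp N" "subspace S'"
  shows "below (extend S) (extend S') \<longleftrightarrow> below S S'"
  unfolding below_def extend_Int_perp_extend[OF assms] psubset_eq
  using extend_subset_iff[OF assms] extend_subset_iff[OF assms(3,4,1,2)] by auto

lemma good_extend_iff:
  assumes "S \<subseteq> perp N" "subspace S"
  shows "good (extend S) \<longleftrightarrow> good S"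
  using extend_Int_perp_extend[OF assms assms] subspace_extend assms
  by (simp add: good_def Rad_def)

lemma extend_surj:
  assumes "subspace Z" "N \<subseteq> Z"
  shows "Z = extend (Z \<inter> perp N)"
proof
  show "extend (Z \<inter> perp N) \<subseteq> Z"
    unfolding extend_def using assms by (auto intro!: subspace_add)
  show "Z \<subseteq> extend (Z \<inter> perp N)"
  proof
    fix z assume "z \<in> Z"
    obtain x where x: "x \<in> N" "z - x \<in> perp N" using nondegenerate_decomposition[OF N] by blast
    then have "z - x \<in> Z \<inter> perp N" using assms \<open>z \<in> Z\<close> by (auto intro: subspace_diff)
    moreover have "z = x + (z - x)" by simp
    ultimately show "z \<in> extend (Z \<inter> perp N)" unfolding extend_def using x(1) by blast
  qed
qed

lemma between_extend:
  assumes S: "S \<subseteq> perp N" "subspace S" and S': "S' \<subseteq> perp N" "subspace S'"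
  shows "between (extend S) (extend S') = extend ` between S S'"
    and "ranked_isomorphism (between S S') extend below dim (dim N)"
proof -
  have sub: "Z \<subseteq> perp N \<and> subspace Z" if "Z \<in> between S S'" for Z
    using that S' by (auto simp: between_iff good_def below_def)
  show "between (extend S) (extend S') = extend ` between S S'"
  proof (intro subset_antisym subsetI)
    fix Z assume Z: "Z \<in> between (extend S) (extend S')"
    then have ZN: "subspace Z" "N \<subseteq> Z"
      using extend_superset[OF S(2)] by (auto simp: between_iff good_def below_def)
    have Zp: "Z \<inter> perp N \<subseteq> perp N" "subspace (Z \<inter> perp N)"
      using ZN by (auto simp: subspace_inter)
    have "extend (Z \<inter> perp N) \<in> between (extend S) (extend S')"
      using Z extend_surj[OF ZN] by simp
    then have "Z \<inter> perp N \<in> between S S'"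
      unfolding between_iff using good_extend_iff[OF Zp] below_extend_iff[OF S Zp]
        below_extend_iff[OF Zp S'] by simp
    then show "Z \<in> extend ` between S S'" using extend_surj[OF ZN] by blast
  next
    fix Z assume "Z \<in> extend ` between S S'"
    then obtain T where "T \<in> between S S'" "Z = extend T" by blast
    then show "Z \<in> between (extend S) (extend S')"
      using sub good_extend_iff below_extend_iff S S' by (simp add: between_iff)
  qed
  show "ranked_isomorphism (between S S') extend below dim (dim N)"
  proof
    show "inj_on extend (between S S')"
      using sub extend_Int_perp by (metis inj_onI)
    show "dim (extend a) = dim a + dim N" if "a \<in> between S S'" for a
      using dim_extend sub[OF that] by blast
    show "below (extend a) (extend b) \<longleftrightarrow> below a b" if "a \<in> between S S'" "b \<in> between S S'" for a b
      using below_extend_iff sub that by blast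
  qed
qed

end

locale symplectic_space_large_field = symplectic_space scale Basis form
  for scale :: "'f::field \<Rightarrow> 'v::ab_group_add \<Rightarrow> 'v" and Basis :: "'v set" and form +
  assumes large_field: "\<exists>t. t \<noteq> (a :: 'f) \<and> t \<noteq> b"
begin

text \<open>A complement \<open>N\<close> of \<open>Rad X\<close> in \<open>X\<close> is nondegenerate. Intersecting with the orthogonal of \<open>N\<close> transforms the
  interval between \<open>X\<close> and \<open>Y\<close> into the one between \<open>Rad X\<close> and \<open>U = Y \<inter> N\<^sup>\<bottom>\<close>, and \<open>Rad X\<close> is zero or spanned by one vector
  outside \<open>U\<^sup>\<bottom>\<close>.\<close>

lemma interval_properties:
  assumes X: "good X" and Y: "good Y" and XY: "below X Y"
  shows "dim X + 2 \<le> dim Y \<Longrightarrow> points (between X Y) dim (Suc (dim X)) \<noteq> {}" (is "_ \<Longrightarrow> ?p")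
    and "dim X + 3 \<le> dim Y \<Longrightarrow> common_neighbours (between X Y) below dim (Suc (dim X))" (is "_ \<Longrightarrow> ?c")
    and "dim X + 4 \<le> dim Y \<Longrightarrow> squares_coned (between X Y) below dim (Suc (dim X))" (is "_ \<Longrightarrow> ?s")
    and "dim X + 4 \<le> dim Y \<Longrightarrow> triangles_filled (between X Y) below dim (Suc (dim X))" (is "_ \<Longrightarrow> ?t")
proof -
  have subX: "subspace X" and subY: "subspace Y" using X Y by (auto simp: good_def)
  obtain N where part: "subspace N" "N \<subseteq> X" "N \<inter> Rad X = {0}" "\<And>x. x \<in> X \<Longrightarrow> \<exists>a\<in>N. x - a \<in> Rad X"
    using subspace_complement[of "Rad X" X] subX by (auto simp: Rad_def subspace_inter)
  have RadN: "Rad X \<subseteq> perp N" using perp_antimono[OF part(2)] by (auto simp: Rad_def)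
  have "N \<inter> perp N \<subseteq> Rad X"
  proof
    fix y assume y: "y \<in> N \<inter> perp N"
    have "form x y = 0" if "x \<in> X" for x
    proof -
      obtain a where a: "a \<in> N" "x - a \<in> Rad X" using part(4) \<open>x \<in> X\<close> by blast
      have "form (x - a) y = 0"
        using a(2) y part(2) form_eq_0_sym by (auto simp: Rad_def perp_def)
      moreover have "form a y = 0" using y a(1) by (auto simp: perp_def)
      ultimately show ?thesis by (simp add: form_diff_left)
    qed
    then show "y \<in> Rad X" using y part(2) by (auto simp: Rad_def perp_def)
  qed
  moreover have "0 \<in> N \<inter> perp N" using subspace_0[OF part(1)] subspace_0[OF subspace_perp] by (rule IntI)
  ultimately have nondeg: "N \<inter> perp N = {0}" using part(3) by blast
  interpret nondegenerate_part scale Basis form N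
    by (rule nondegenerate_part.intro[OF symplectic_space_axioms
        nondegenerate_part_axioms.intro[OF part(1) nondeg]])
  define U where "U = Y \<inter> perp N"
  have "N \<subseteq> Y" using part(2) XY by (auto simp: below_def)
  have YU: "Y = extend U" unfolding U_def by (rule extend_surj[OF subY \<open>N \<subseteq> Y\<close>])
  have subU: "U \<subseteq> perp N" "subspace U" using subY by (auto simp: U_def subspace_inter)
  have subR: "subspace (Rad X)" using subX by simp
  have "X \<inter> perp N = Rad X"
  proof
    show "Rad X \<subseteq> X \<inter> perp N" using RadN by (auto simp: Rad_def)
    show "X \<inter> perp N \<subseteq> Rad X"
    proof
      fix x assume x: "x \<in> X \<inter> perp N"
      then obtain a where a: "a \<in> N" "x - a \<in> Rad X" using part(4) by blast
      have "x - (x - a) \<in> perp N" by (rule subspace_diff) (use x a RadN in auto)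
      then have "a = 0" using a(1) nondeg by auto
      then show "x \<in> Rad X" using a(2) by simp
    qed
  qed
  then have XR: "X = extend (Rad X)" using extend_surj[OF subX part(2)] by simp
  have bt: "between X Y = extend ` between (Rad X) U"
    using between_extend(1)[OF RadN subR subU] XR YU by simp
  interpret iso: ranked_isomorphism "between (Rad X) U" extend below dim "dim N"
    by (rule between_extend(2)[OF RadN subR subU])
  have dims: "dim X = dim (Rad X) + dim N" "dim Y = dim U + dim N"
    using dim_extend[OF RadN subR] dim_extend[OF subU] XR YU by simp_all
  have "good U" using good_extend_iff[OF subU] Y YU by simp
  then interpret GU: good_subspace scale Basis form U
    using large_field by unfold_locales
  have RU: "below (Rad X) U" using below_extend_iff[OF RadN subR subU] XY XR YU by simp
  consider "Rad X = {0}" | r where "r \<noteq> 0" "Rad X = span {r}"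
  proof (cases "Rad X = {0}")
    case False
    then obtain r where r: "r \<in> Rad X" "r \<noteq> 0" using subspace_0[OF subR] by blast
    then have "span {r} = Rad X"
      using subspace_dim_equal[of "span {r}" "Rad X"] subR X by (simp add: span_subset good_def)
    then show ?thesis using that r by blast
  qed (use that in blast)
  then have "(dim X + 2 \<le> dim Y \<longrightarrow> ?p) \<and> (dim X + 3 \<le> dim Y \<longrightarrow> ?c)
      \<and> (dim X + 4 \<le> dim Y \<longrightarrow> ?s) \<and> (dim X + 4 \<le> dim Y \<longrightarrow> ?t)"
  proof cases
    case 1
    then have "Suc (dim X) = Suc 0 + dim N" using dims by simp
    then show ?thesis
      unfolding bt 1 using iso.points_image[of "Suc 0"] iso.common_neighbours_image[of "Suc 0"]
        iso.squares_coned_image[of "Suc 0"] iso.triangles_filled_image[of "Suc 0"]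
        GU.point_exists_E0 GU.common_neighbours_E0 GU.squares_coned_E0 GU.triangles_filled_E0 1 dims
      by simp
  next
    case (2 r)
    have "r \<in> span {r}" by (simp add: span_base)
    then have "r \<in> U" "r \<notin> perp U" using RU 2 by (auto simp: below_def)
    then interpret GUr: good_subspace_with_vector scale Basis form U r
      by unfold_locales
    have "Suc (dim X) = Suc (Suc 0) + dim N" using dims 2 by simp
    then show ?thesis
      unfolding bt 2(2) using iso.points_image[of "Suc (Suc 0)"]
        iso.common_neighbours_image[of "Suc (Suc 0)"] iso.squares_coned_image[of "Suc (Suc 0)"]
        iso.triangles_filled_image[of "Suc (Suc 0)"]
        GUr.point_exists_E1 GUr.common_neighbours_E1 GUr.squares_coned_E1 GUr.triangles_filled_E1 2 dims
      by simp
  qed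
  then show "dim X + 2 \<le> dim Y \<Longrightarrow> ?p" "dim X + 3 \<le> dim Y \<Longrightarrow> ?c"
    "dim X + 4 \<le> dim Y \<Longrightarrow> ?s" "dim X + 4 \<le> dim Y \<Longrightarrow> ?t" by blast+
qed

lemma line_unique:
  assumes sub: "subspace p" "subspace q" "subspace l" "subspace m" and pq: "p \<noteq> q" "dim p = dim q"
    and "p \<subseteq> l" "q \<subseteq> l" "p \<subseteq> m" "q \<subseteq> m" "dim l = Suc (dim p)" "dim m = Suc (dim p)"
  shows "l = m"
proof -
  have "\<not> q \<subseteq> p" using subspace_dim_equal[OF sub(2,1)] pq by auto
  then have "p \<subset> span (p \<union> q)" using span_superset[of "p \<union> q"] by blast
  then have "dim p < dim (span (p \<union> q))" by (intro dim_less) (simp_all add: sub)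
  then have "span (p \<union> q) = k" if "k \<in> {l, m}" for k
    using that assms subspace_dim_equal[of "span (p \<union> q)" k] span_subset[of k "p \<union> q"] by auto
  then show ?thesis by blast
qed

sublocale point_line: point_line_geometry "Collect good" below dim
proof
  fix p q l m
  assume "p \<in> Collect good" "q \<in> Collect good" "l \<in> Collect good" "m \<in> Collect good"
    "p \<noteq> q" "dim p = dim q" "dim l = Suc (dim p)" "dim m = Suc (dim p)"
    "below p l" "below q l" "below p m" "below q m"
  then show "l = m" using line_unique[of p q l m] by (auto simp: good_def below_def)
qed (use interval_properties in simp_all)

end

section \<open>The symplectic geometry as an interval\<close>

text \<open>Needed because \<open>Gamma_inc\<close> and \<open>incident below\<close> agree on subspaces, but not on arbitrary sets.\<close>

lemma incidence_cong:
  assumes "\<And>x y. x \<in> Ob \<Longrightarrow> y \<in> Ob \<Longrightarrow> inc x y \<longleftrightarrow> inc' x y"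
  shows "inc_simply_connected Ob inc \<longleftrightarrow> inc_simply_connected Ob inc'"
proof -
  have "successively (\<lambda>x y. x \<noteq> y \<and> inc x y) p \<longleftrightarrow> successively (\<lambda>x y. x \<noteq> y \<and> inc' x y) p"
    if "set p \<subseteq> Ob" for p
    using that by (intro successively_cong) (use assms in auto)
  then have path: "inc_path Ob inc = inc_path Ob inc'"
    unfolding inc_path_def by (intro ext) blast
  have "inc_cycle Ob inc = inc_cycle Ob inc'"
    unfolding inc_cycle_def path by (rule refl)
  then have "inc_homotopic Ob inc = inc_homotopic Ob inc'"
    unfolding inc_homotopic_def cycle_insertion_def path by simp
  then show ?thesis
    unfolding inc_simply_connected_def inc_connected_def path \<open>inc_cycle Ob inc = inc_cycle Ob inc'\<close>
    by simp
qed

context symplectic_space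
begin

lemma Gamma_objects_eq:
  assumes "dim (UNIV :: 'v set) \<noteq> 0"
  shows "Gamma_objects = between {0} UNIV"
proof (intro set_eqI)
  fix Z :: "'v set"
  have "dim Z \<in> Gamma_types \<longleftrightarrow> Z \<noteq> {0} \<and> Z \<noteq> UNIV" if Z: "subspace Z"
  proof -
    have "dim Z = 0 \<longleftrightarrow> Z = {0}" using dim_eq_0[of Z] subspace_0[OF Z] by auto
    moreover have "dim Z < dim (UNIV :: 'v set) \<longleftrightarrow> Z \<noteq> UNIV"
      using dim_less[OF Z subspace_UNIV] by auto
    moreover have "dim Z \<in> Gamma_types \<longleftrightarrow> dim Z \<noteq> 0 \<and> dim Z < dim (UNIV :: 'v set)"
      unfolding Gamma_types_def atLeastAtMost_iff using assms by linarith
    ultimately show ?thesis by simp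
  qed
  moreover have "below {0} Z \<longleftrightarrow> Z \<noteq> {0}" if "subspace Z"
    using below_zero[OF that] by (auto simp: below_def)
  moreover have "below Z UNIV \<longleftrightarrow> Z \<noteq> UNIV \<and> Z \<inter> Rad UNIV = {0}"
    by (auto simp: below_def Rad_def)
  ultimately show "Z \<in> Gamma_objects \<longleftrightarrow> Z \<in> between {0} UNIV"
    unfolding Gamma_objects_def between_iff good_def mem_Collect_eq by metis
qed

lemma Gamma_inc_eq:
  assumes "subspace X" "subspace Y"
  shows "Gamma_inc X Y \<longleftrightarrow> incident below X Y"
proof -
  have "dim A < dim B \<and> A \<subseteq> B \<and> A \<inter> Rad B = {0} \<longleftrightarrow> below A B"
    if "subspace A" "subspace B" for A B
    using dim_less[OF that] by (auto simp: below_def Rad_def)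
  then show ?thesis using assms by (simp add: Gamma_inc_def incident_def)
qed

lemma good_UNIV: "maximal_rank \<Longrightarrow> good UNIV"
  by (simp add: good_def maximal_rank_def)

lemma good_zero: "good {0}"
proof -
  have "dim (Rad {0}) \<le> dim {0}" by (rule dim_subset) (simp add: Rad_def)
  also have "dim {0} \<le> 1" by simp
  finally show ?thesis unfolding good_def using subspace_single_0 by blast
qed

end

theorem proposition4p7:
  fixes scale :: "'f::field \<Rightarrow> 'v::ab_group_add \<Rightarrow> 'v"
    and Basis :: "'v set"
    and form :: "'v \<Rightarrow> 'v \<Rightarrow> 'f"
    and F :: "'v set set"
  defines "Ob \<equiv> symplectic_space.Gamma_objects scale form"
    and "inc \<equiv> symplectic_space.Gamma_inc scale form"
    and "I \<equiv> symplectic_space.Gamma_types scale"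
  assumes "symplectic_space scale Basis form"
    and "symplectic_space.maximal_rank scale form"
    and "infinite (UNIV :: 'f set) \<or> 3 \<le> card (UNIV :: 'f set)"
    and "flag Ob inc F"
    and "3 \<le> residue_rank I F"
  shows "inc_simply_connected (flag_residue Ob inc F) inc"
proof -
  interpret symplectic_space scale Basis form by fact
  have "\<exists>t. t \<noteq> a \<and> t \<noteq> b" for a b :: 'f
  proof (rule ccontr)
    assume "\<not> (\<exists>t. t \<noteq> a \<and> t \<noteq> b)"
    then have UNIV: "(UNIV :: 'f set) = {a, b}" by blast
    moreover have "finite {a, b}" "card {a, b} \<le> 2" by (simp_all add: card_insert_if)
    ultimately have "finite (UNIV :: 'f set)" "card (UNIV :: 'f set) \<le> 2" by simp_all
    then show False using assms(6) by simp
  qed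
  then interpret symplectic_space_large_field scale Basis form by unfold_locales
  have rank: "card F + 4 \<le> dim (UNIV :: 'v set)"
    using assms(8) by (simp add: residue_rank_def I_def Gamma_types_def)
  then have Ob: "Ob = between {0} UNIV" unfolding Ob_def by (intro Gamma_objects_eq) simp
  have inc: "inc X Y \<longleftrightarrow> incident below X Y" if "X \<in> Ob" "Y \<in> Ob" for X Y
    unfolding inc_def using that Gamma_inc_eq by (simp add: Ob between_iff good_def)
  have F: "F \<subseteq> Ob" using assms(7) by (simp add: flag_def)
  then have flag: "flag (between {0} UNIV) (incident below) F"
    using assms(7) inc Ob unfolding flag_def by blast
  \<comment> \<open>Incident objects of the same dimension coincide, so the flag is finite.\<close>
have "inj_on dim F"
  proof (rule inj_onI, rule ccontr)
    fix X Y assume XY: "X \<in> F" "Y \<in> F" "dim X = dim Y" "X \<noteq> Y"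
    then have "below X Y \<or> below Y X" using flag by (auto simp: flag_def incident_def)
    moreover have "subspace X" "subspace Y" using XY F by (auto simp: Ob between_iff good_def)
    ultimately show False using XY(3) dim_less[of X Y] dim_less[of Y X] by (auto simp: below_def)
  qed
  moreover have "dim ` F \<subseteq> {..dim (UNIV :: 'v set)}" using dim_subset[OF subset_UNIV] by blast
  ultimately have "finite F" by (meson finite_atMost finite_subset finite_imageD)
  have "dim (UNIV :: 'v set) \<noteq> dim {0}" using rank by simp
  then have "(UNIV :: 'v set) \<noteq> {0}" by metis
  then have "below {0} UNIV" by (rule below_zero[OF subspace_UNIV])
  then have "inc_simply_connected (flag_residue (between {0} UNIV) (incident below) F) (incident below)"
    using point_line.flag_residue_simply_connected[of "{0}" UNIV F] good_zero good_UNIV[OF assms(5)]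
      \<open>finite F\<close> flag rank by simp
  moreover have "flag_residue (between {0} UNIV) (incident below) F = flag_residue Ob inc F"
    using inc F Ob unfolding flag_residue_def by blast
  moreover have "inc_simply_connected (flag_residue Ob inc F) inc
      \<longleftrightarrow> inc_simply_connected (flag_residue Ob inc F) (incident below)"
    by (rule incidence_cong) (auto simp: flag_residue_def inc)
  ultimately show ?thesis by simp
qed

end
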